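(* Let $m_1,m_2,\overline{k}_0,\overline{k}_2,r>0$ and $\widetilde{k}_0,\widetilde{k}_2\in\mathbb{R}$, and suppose that $$4\left(\frac{\overline{k}_2+\overline{k}_0}{m_2}+\frac{\overline{k}_0}{m_1}\right)^2=25\,\frac{\overline{k}_0\overline{k}_2}{m_1m_2},$$ so that the frequencies of the generating system are $\omega_1=\omega$ and $\omega_2=2\omega$ (with $\omega>0$ as defined in the context). Let $\widetilde\eta(t)=r\cos(\omega t)$. Suppose $\alpha>0$, $\gamma>0$ (with $\alpha,\beta,\gamma,\mu$ as in the context) and $m_1m_2\omega^2\neq\overline{k}_0(m_1+m_2)$. Then there exist $\delta>0$ and, for each $\widehat{k}_1\in(0,\delta]$, real numbers $A_{1C,\widehat{k}_1},A_{1S,\widehat{k}_1},A_{2C,\widehat{k}_1},A_{2S,\widehat{k}_1}$ with $A_{2C,\widehat{k}_1}\neq0$ or $A_{2S,\widehat{k}_1}\neq0$, such that: (i) for each $\widehat{k}_1\in(0,\delta]$ there is $\varepsilon_0>0$ such that for every $\varepsilon\in(0,\varepsilon_0]$ the resonance screen system with parameters $\widehat{k}_1,\varepsilon$ (see context) has a unique $\frac{2\pi}{\omega}$-periodic solution $(x_{1,\varepsilon},x_{2,\varepsilon})$ such that, as $\varepsilon\to0$, $$x_{1,\varepsilon}(t)\to-\overline{k}_0A_{1C,\widehat{k}_1}\sin(\omega t)-\overline{k}_0A_{1S,\widehat{k}_1}\cos(\omega t)-\overline{k}_0A_{2C,\widehat{k}_1}\sin(2\omega t)-\overline{k}_0A_{2S,\widehat{k}_1}\cos(2\omega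 t),$$ $$x_{2,\varepsilon}(t)\to(m_1\omega^2-\overline{k}_0)\bigl(A_{1C,\widehat{k}_1}\sin(\omega t)+A_{1S,\widehat{k}_1}\cos(\omega t)\bigr)+(4m_1\omega^2-\overline{k}_0)\bigl(A_{2C,\widehat{k}_1}\sin(2\omega t)+A_{2S,\widehat{k}_1}\cos(2\omega t)\bigr);$$ (ii) $(A_{1C,\widehat{k}_1},A_{1S,\widehat{k}_1},A_{2C,\widehat{k}_1},A_{2S,\widehat{k}_1})\to\left(\frac{\mu\alpha}{\alpha^2+\beta^2},\frac{\mu\beta}{\alpha^2+\beta^2},0,0\right)$ as $\widehat{k}_1\to0$; (iii) the solution $(x_{1,\varepsilon},x_{2,\varepsilon})$ is asymptotically stable.
   Context: The resonance screen system (two-mass resonance screen with one-sided stop without gap) is $$m_1\ddot{x}_1+\varepsilon\dot P(x_1-x_2)(\dot x_1-\dot x_2)-\varepsilon k_0(\dot\eta(t)-\dot x_1+\dot x_2)+P(x_1-x_2)-k_0(\eta(t)-x_1+x_2)=0,$$ $$m_2\ddot{x}_2-\varepsilon\dot P(x_1-x_2)(\dot x_1-\dot x_2)+\varepsilon k_2\dot x_2+\varepsilon k_0(\dot\eta(t)-\dot x_1+\dot x_2)-P(x_1-x_2)+k_2x_2+k_0(\eta(t)-x_1+x_2)=0,$$ where $P(\Delta)=\varepsilon\widehat{k}_1\max\{0,\Delta\}$, $\dot P$ is the (piecewise constant) derivative of $P$, $k_0=\overline{k}_0+\varepsilon\widetilde{k}_0$, $k_2=\overline{k}_2+\varepsilon\widetilde{k}_2$,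 $\overline{k}_0\,\eta(t)=\varepsilon\,\widetilde\eta(t)$, and $\varepsilon>0$ is a small parameter. The term $\dot P(x_1-x_2)(\dot x_1-\dot x_2)$ is understood as the time derivative of $P(x_1(t)-x_2(t))$; that is, the system is understood as the first-order system obtained by using $x_1$, $x_2$, $y_1=m_1\dot x_1+\varepsilon P(x_1-x_2)$ and $y_2=m_2\dot x_2-\varepsilon P(x_1-x_2)$ as unknowns. Asymptotic stability is in the Lyapunov sense. The generating system ($\varepsilon=0$) is $m_1\ddot x_1+\overline{k}_0(x_1-x_2)=0$, $m_2\ddot x_2-\overline{k}_0(x_1-x_2)+\overline{k}_2x_2=0$; its frequencies $0<\omega_1<\omega_2$ are given by $$\omega_{1,2}^2=\frac12\left(\frac{\overline{k}_0+\overline{k}_2}{m_2}+\frac{\overline{k}_0}{m_1}\right)\mp\frac12\sqrt{\left(\frac{\overline{k}_0+\overline{k}_2}{m_2}-\frac{\overline{k}_0}{m_1}\right)^2+\frac{4\overline{k}_0^2}{m_1m_2}},$$ and $\omega:=\omega_1$. Put $$\alpha=\frac{\omega}{6}\left(\frac{\overline{k}_0\overline{k}_2}{m_1m_2\omega^3}-\frac{\overline{k}_0}{m_1\omega}-\frac{\overline{k}_0+\overline{k}_2}{m_2\omega}+4\omega\right),$$ $$\beta=\frac{\omega}{6}\left(\frac{4\widetilde{k}_0}{\overline{k}_0}+\frac{\overline{k}_0\widetilde{k}_2}{m_1m_2\omega^4}-\frac{\widetilde{k}_0}{m_1\omega^2}-\frac{\widetilde{k}_0+\widetilde{k}_2}{m_2\omega^2}\right),$$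 $$\gamma=\frac{\omega}{6}\left(\frac{4\overline{k}_0}{m_1\omega}+\frac{4\overline{k}_0}{m_2\omega}+\frac{4\overline{k}_2}{m_2\omega}-\frac{\overline{k}_0\overline{k}_2}{m_1m_2\omega^3}-4\omega\right),$$ $$\mu=\frac{1}{6m_1\omega^3}\left(\frac1{m_1}+\frac1{m_2}\right)r-\frac{2}{3\overline{k}_0m_1\omega}r.$$ *)

theory Defs
  imports "HOL-Analysis.Analysis"
begin

text \<open>
  Naming: \<open>k0b, k2b\<close> are the unperturbed stiffnesses (bars), \<open>k0t, k2t\<close> their first order
  perturbations (tildes), \<open>k1h\<close> is the stiffness coefficient of the one-sided stop (hat).
\<close>

definition stop_force :: "real \<Rightarrow> real \<Rightarrow> real \<Rightarrow> real" where
  "stop_force k1h \<epsilon> \<Delta> = \<epsilon> * k1h * max 0 \<Delta>"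

definition omega1 :: "real \<Rightarrow> real \<Rightarrow> real \<Rightarrow> real \<Rightarrow> real" where
  "omega1 m1 m2 k0b k2b =
     sqrt (1 / 2 * ((k0b + k2b) / m2 + k0b / m1)
           - 1 / 2 * sqrt (((k0b + k2b) / m2 - k0b / m1)\<^sup>2 + 4 * k0b\<^sup>2 / (m1 * m2)))"

definition coef_alpha :: "real \<Rightarrow> real \<Rightarrow> real \<Rightarrow> real \<Rightarrow> real \<Rightarrow> real" where
  "coef_alpha m1 m2 k0b k2b \<omega> =
     \<omega> / 6 * (k0b * k2b / (m1 * m2 * \<omega> ^ 3) - k0b / (m1 * \<omega>) - (k0b + k2b) / (m2 * \<omega>) + 4 * \<omega>)"

definition coef_beta :: "real \<Rightarrow> real \<Rightarrow> real \<Rightarrow> real \<Rightarrow> real \<Rightarrow> real \<Rightarrow> real" where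
  "coef_beta m1 m2 k0b k0t k2t \<omega> =
     \<omega> / 6 * (4 * k0t / k0b + k0b * k2t / (m1 * m2 * \<omega> ^ 4)
              - k0t / (m1 * \<omega>\<^sup>2) - (k0t + k2t) / (m2 * \<omega>\<^sup>2))"

definition coef_gamma :: "real \<Rightarrow> real \<Rightarrow> real \<Rightarrow> real \<Rightarrow> real \<Rightarrow> real" where
  "coef_gamma m1 m2 k0b k2b \<omega> =
     \<omega> / 6 * (4 * k0b / (m1 * \<omega>) + 4 * k0b / (m2 * \<omega>) + 4 * k2b / (m2 * \<omega>)
              - k0b * k2b / (m1 * m2 * \<omega> ^ 3) - 4 * \<omega>)"

definition coef_mu :: "real \<Rightarrow> real \<Rightarrow> real \<Rightarrow> real \<Rightarrow> real \<Rightarrow> real" where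
  "coef_mu m1 m2 k0b r \<omega> =
     1 / (6 * m1 * \<omega> ^ 3) * (1 / m1 + 1 / m2) * r - 2 / (3 * k0b * m1 * \<omega>) * r"

text \<open>A state is \<open>(x1, x2, y1, y2)\<close> with \<open>y1 = m1 x1' + \<epsilon> P (x1 - x2)\<close> and
  \<open>y2 = m2 x2' - \<epsilon> P (x1 - x2)\<close>.\<close>

type_synonym state = "real \<times> real \<times> real \<times> real"

definition pos1 :: "state \<Rightarrow> real" where "pos1 = fst"
definition pos2 :: "state \<Rightarrow> real" where "pos2 = fst \<circ> snd"

text \<open>
  The locals \<open>v1, v2\<close> are the velocities \<open>x1', x2'\<close> expressed through the state. The terms
  \<open>\<epsilon> (d/dt) P (x1 - x2)\<close> of the second order system are absorbed in \<open>y1', y2'\<close>.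
\<close>

definition screen_field ::
  "real \<Rightarrow> real \<Rightarrow> real \<Rightarrow> real \<Rightarrow> real \<Rightarrow> real \<Rightarrow> (real \<Rightarrow> real) \<Rightarrow> real \<Rightarrow> real \<Rightarrow> real \<Rightarrow> state \<Rightarrow> state" where
  "screen_field m1 m2 k0b k2b k0t k2t \<eta>t k1h \<epsilon> t = (\<lambda>(x1, x2, y1, y2).
     let k0 = k0b + \<epsilon> * k0t;
         k2 = k2b + \<epsilon> * k2t;
         \<eta> = (\<lambda>s. \<epsilon> * \<eta>t s / k0b);
         P = stop_force k1h \<epsilon> (x1 - x2);
         v1 = (y1 - \<epsilon> * P) / m1;
         v2 = (y2 + \<epsilon> * P) / m2
     in (v1,
         v2,
         \<epsilon> * k0 * (deriv \<eta> t - v1 + v2) - P + k0 * (\<eta> t - x1 + x2),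
         - (\<epsilon> * k2 * v2) - \<epsilon> * k0 * (deriv \<eta> t - v1 + v2) + P - k2 * x2 - k0 * (\<eta> t - x1 + x2)))"

definition solves_on :: "(real \<Rightarrow> state \<Rightarrow> state) \<Rightarrow> real set \<Rightarrow> (real \<Rightarrow> state) \<Rightarrow> bool" where
  "solves_on f S z \<longleftrightarrow> (\<forall>t\<in>S. (z has_vector_derivative f t (z t)) (at t within S))"

definition periodic_solution :: "(real \<Rightarrow> state \<Rightarrow> state) \<Rightarrow> real \<Rightarrow> (real \<Rightarrow> state) \<Rightarrow> bool" where
  "periodic_solution f T z \<longleftrightarrow> solves_on f UNIV z \<and> (\<forall>t. z (t + T) = z t)"

text \<open>
  Lyapunov (asymptotic) stability of a solution \<open>z\<close>. Only perturbed solutions that exist on all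
  of \<open>[t0, \<infinity>)\<close> are considered; \<open>screen_field\<close> is globally Lipschitz in the state, so
  every initial state has exactly one such solution.
\<close>

definition lyapunov_stable :: "(real \<Rightarrow> state \<Rightarrow> state) \<Rightarrow> (real \<Rightarrow> state) \<Rightarrow> bool" where
  "lyapunov_stable f z \<longleftrightarrow>
     (\<forall>t0. \<forall>e>0. \<exists>d>0. \<forall>w. solves_on f {t0..} w \<and> dist (w t0) (z t0) < d \<longrightarrow>
        (\<forall>t\<ge>t0. dist (w t) (z t) < e))"

definition asymptotically_stable :: "(real \<Rightarrow> state \<Rightarrow> state) \<Rightarrow> (real \<Rightarrow> state) \<Rightarrow> bool" where
  "asymptotically_stable f z \<longleftrightarrow> lyapunov_stable f z \<and>
     (\<forall>t0. \<exists>d>0. \<forall>w. solves_on f {t0..} w \<and> dist (w t0) (z t0) < d \<longrightarrow>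
        ((\<lambda>t. dist (w t) (z t)) \<longlongrightarrow> 0) at_top)"

definition limit1 :: "real \<Rightarrow> real \<Rightarrow> real \<Rightarrow> real \<Rightarrow> real \<Rightarrow> real \<Rightarrow> real \<Rightarrow> real" where
  "limit1 k0b \<omega> a1C a1S a2C a2S t =
     - k0b * a1C * sin (\<omega> * t) - k0b * a1S * cos (\<omega> * t)
     - k0b * a2C * sin (2 * \<omega> * t) - k0b * a2S * cos (2 * \<omega> * t)"

definition limit2 :: "real \<Rightarrow> real \<Rightarrow> real \<Rightarrow> real \<Rightarrow> real \<Rightarrow> real \<Rightarrow> real \<Rightarrow> real \<Rightarrow> real" where
  "limit2 m1 k0b \<omega> a1C a1S a2C a2S t =
     (m1 * \<omega>\<^sup>2 - k0b) * (a1C * sin (\<omega> * t) + a1S * cos (\<omega> * t))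
     + (4 * m1 * \<omega>\<^sup>2 - k0b) * (a2C * sin (2 * \<omega> * t) + a2S * cos (2 * \<omega> * t))"

text \<open>
  Being a limit as \<open>\<epsilon> \<rightarrow> 0\<close> does not single out a solution at a fixed \<open>\<epsilon>\<close>; uniqueness of the
  periodic solution is stated in a neighbourhood of the limiting motion that does not depend
  on \<open>\<epsilon>\<close>. This says the same as: two families of periodic solutions that converge (uniformly)
  to the limiting motion agree for all small \<open>\<epsilon>\<close>.
\<close>

definition positions_near :: "real \<Rightarrow> (real \<Rightarrow> real) \<Rightarrow> (real \<Rightarrow> real) \<Rightarrow> (real \<Rightarrow> state) \<Rightarrow> bool" where
  "positions_near \<rho> X1 X2 z \<longleftrightarrow> (\<forall>t. \<bar>pos1 (z t) - X1 t\<bar> < \<rho> \<and> \<bar>pos2 (z t) - X2 t\<bar> < \<rho>)"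

end

theory Submission
  imports Defs "HOL-Analysis.Analysis"
begin

text \<open>
  Expanded in \<open>\<epsilon>\<close>, the vector field of the screen is \<open>A z + \<epsilon> g (t, z) + O(\<epsilon>\<^sup>2)\<close>, where \<open>A\<close> is the linear
  generating system and \<open>g\<close> collects the damping, the detuning, the forcing and the stop; everything
  is Lipschitz in the state, uniformly in \<open>\<epsilon>\<close>. The damping is proportional to the stiffness matrix,
  hence complete. A quadratic form \<open>H + \<epsilon> Q\<close> (the energy \<open>H\<close> plus a correction) therefore decays
  along differences of solutions at a rate of order \<open>\<epsilon>\<close>, and this persists for a stop that is soft
  compared with the damping (\<open>first_order_dissipative\<close>): for small \<open>k1h\<close> and then small \<open>\<epsilon>\<close> the screen
  is a contracting system, although it is not smooth. This gives at once existence, uniqueness and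
  exponential stability of a periodic solution (locale \<open>contracting_field\<close>), uniqueness even without
  restriction to a neighbourhood of the limiting motion.

  The limit is found by a first order expansion. For a free motion \<open>z0\<close> of the generating system, the
  equation \<open>w' = A w + g (t, z0)\<close> has a periodic solution \<open>w\<close> if \<open>g (t, z0)\<close> is not in resonance with
  the two modes; these four conditions on the amplitudes are the averaged equations
  (\<open>averaged_equilibrium\<close>, \<open>corrector_exists\<close>). Then \<open>z0 + \<epsilon> w\<close> solves the equation up to \<open>O(\<epsilon>\<^sup>2)\<close>, and
  with a contraction rate of order \<open>\<epsilon>\<close> the periodic solution is \<open>O(\<epsilon>)\<close>-close to \<open>z0\<close>
  (\<open>weakly_perturbed_periodic\<close>).

  The averaged equations have the form \<open>a = a0 + k1h \<Psi> a\<close> with \<open>\<Psi>\<close> Lipschitz and \<open>a0\<close> the equilibrium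
  without stop, which gives the amplitudes and their limit (\<open>averaged_equilibria\<close>). If both
  amplitudes of the second mode vanished, the stop force would be a half-wave rectified oscillation of
  frequency \<open>\<omega>\<close> without second harmonic; that forces it and the first amplitudes to vanish
  (\<open>half_wave_second_harmonic\<close>), which \<open>\<mu> \<noteq> 0\<close> excludes.
\<close>

section \<open>Periodic functions and their antiderivatives\<close>

lemma periodic_int_shift:
  fixes h :: "real \<Rightarrow> 'a" and n :: int
  assumes "\<And>t. h (t + T) = h t"
  shows "h (t + of_int n * T) = h t"
proof (induction n arbitrary: t rule: int_induct[of _ 0])
  case (step1 i)
  have "h (t + of_int (i + 1) * T) = h ((t + of_int i * T) + T)"
    by (simp add: algebra_simps)
  then show ?case using assms step1 by simp
next
  case (step2 i)
  have "h (t + of_int (i - 1) * T) = h ((t + of_int (i - 1) * T) + T)"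
    using assms by simp
  also have "\<dots> = h (t + of_int i * T)" by (simp add: algebra_simps)
  finally show ?case using step2 by simp
qed simp

lemma periodic_representative:
  fixes h :: "real \<Rightarrow> 'a"
  assumes "\<And>t. h (t + T) = h t" "T > 0"
  obtains s where "s \<in> {0..T}" "h s = h t"
proof
  have "t / T \<le> of_int \<lfloor>t / T\<rfloor> + 1" by linarith
  then have T: "of_int \<lfloor>t / T\<rfloor> * T \<le> t" "t \<le> (of_int \<lfloor>t / T\<rfloor> + 1) * T"
    using floor_correct[of "t / T"] \<open>T > 0\<close>
    by (simp_all only: le_divide_eq pos_divide_le_eq if_True)
  show "t + of_int (- \<lfloor>t / T\<rfloor>) * T \<in> {0..T}"
    using T by (simp add: algebra_simps)
  show "h (t + of_int (- \<lfloor>t / T\<rfloor>) * T) = h t"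
    using periodic_int_shift[of h T t "- \<lfloor>t / T\<rfloor>"] assms(1) by blast
qed

lemma periodic_attains_max:
  fixes h :: "real \<Rightarrow> real"
  assumes "\<And>t. h (t + T) = h t" "T > 0" "continuous_on UNIV h"
  obtains m where "\<And>t. h t \<le> h m"
proof -
  have "continuous_on {0..T} h" using assms(3) by (rule continuous_on_subset) simp
  then obtain m where m: "m \<in> {0..T}" "\<forall>t\<in>{0..T}. h t \<le> h m"
    using continuous_attains_sup[of "{0..T}" h] assms(2) by auto
  have "h t \<le> h m" for t
  proof -
    obtain s where "s \<in> {0..T}" "h s = h t"
      using periodic_representative[of h T t] assms(1,2) by blast
    then show ?thesis using m(2) by metis
  qed
  then show ?thesis using that by blast
qed

lemma periodic_bounded:
  fixes h :: "real \<Rightarrow> 'a::real_normed_vector"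
  assumes "\<And>t. h (t + T) = h t" "T > 0" "continuous_on UNIV h"
  obtains K where "K \<ge> 0" "\<And>t. norm (h t) \<le> K"
proof -
  obtain m where m: "\<And>t. norm (h t) \<le> norm (h m)"
    using periodic_attains_max[of "\<lambda>t. norm (h t)" T] assms continuous_on_norm by metis
  show ?thesis by (rule that[of "norm (h m)"]) (auto simp: m)
qed

lemma antiderivative_exists:
  fixes g :: "real \<Rightarrow> 'a::euclidean_space"
  assumes "continuous_on UNIV g"
  obtains G where "\<And>t. (G has_vector_derivative g t) (at t)"
proof -
  have "isCont g x" for x
    using assms continuous_on_eq_continuous_at[of UNIV g] by simp
  then show ?thesis
    using einterval_antiderivative[of "-\<infinity>" \<infinity> g] that by auto
qed

lemma zero_derivative_imp_const:
  fixes G :: "real \<Rightarrow> 'a::real_normed_vector"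
  assumes "\<And>t. (G has_vector_derivative 0) (at t)"
  shows "G s = G t"
proof -
  obtain c where "\<And>x. x \<in> UNIV \<Longrightarrow> G x = c"
    using has_vector_derivative_zero_constant[of UNIV G] assms by auto
  then show ?thesis by simp
qed

lemma has_vector_derivative_periodic_shift:
  assumes "\<And>t. (G has_vector_derivative g t) (at t)"
  shows "((\<lambda>t. G (t + T)) has_vector_derivative g (t + T)) (at t)"
  using has_vector_derivative_shift[of G g] assms
    vector_diff_chain_at[of "\<lambda>t. t + T" 1 t G "g (t + T)"]
  by (simp add: o_def has_vector_derivative_add_const)

lemma periodic_antiderivative_exists:
  fixes g :: "real \<Rightarrow> 'a::euclidean_space"
  assumes "continuous_on UNIV g" "\<And>t. g (t + T) = g t" "T > 0" "(g has_integral 0) {0..T}"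
  obtains G where "\<And>t. (G has_vector_derivative g t) (at t)" "\<And>t. G (t + T) = G t"
proof -
  obtain G where G: "\<And>t. (G has_vector_derivative g t) (at t)"
    using antiderivative_exists[OF assms(1)] by blast
  have "(g has_integral (G T - G 0)) {0..T}"
    by (rule fundamental_theorem_of_calculus)
      (use assms(3) G in \<open>auto intro: less_imp_le has_vector_derivative_at_within\<close>)
  then have "G T - G 0 = 0" using assms(4) by (rule has_integral_unique)
  then have GT: "G T = G 0" by simp
  have "((\<lambda>t. G (t + T) - G t) has_vector_derivative 0) (at t)" for t
    using has_vector_derivative_diff[OF has_vector_derivative_periodic_shift[OF G, of T t] G[of t]]
      assms(2) by simp
  then have "G (t + T) - G t = G (0 + T) - G 0" for t
    by (rule zero_derivative_imp_const)
  then show ?thesis using that[OF G] GT by simp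
qed

text \<open>The operator \<open>(d/dt + M)\<close> is onto on periodic functions; the constant of integration is
  chosen so that the boundary values agree.\<close>

lemma periodic_linear_ode_exists:
  fixes g :: "real \<Rightarrow> 'a::euclidean_space"
  assumes g: "continuous_on UNIV g" "\<And>t. g (t + T) = g t" and T: "T > 0" and M: "M > 0"
  obtains h where "\<And>t. (h has_vector_derivative (g t - M *\<^sub>R h t)) (at t)" "\<And>t. h (t + T) = h t"
proof -
  have "continuous_on UNIV (\<lambda>t. exp (M * t) *\<^sub>R g t)"
    by (intro continuous_intros g)
  then obtain G where G: "\<And>t. (G has_vector_derivative exp (M * t) *\<^sub>R g t) (at t)"
    using antiderivative_exists by blast
  define C where "C = (1 / (exp (M * T) - 1)) *\<^sub>R (G T - exp (M * T) *\<^sub>R G 0)"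
  define h where "h = (\<lambda>t. exp (- (M * t)) *\<^sub>R (G t + C))"
  have e: "exp (M * T) - 1 \<noteq> 0" using T M by simp
  have h': "(h has_vector_derivative (g t - M *\<^sub>R h t)) (at t)" for t
    unfolding h_def
    by (rule derivative_eq_intros G | simp)+
      (simp add: exp_minus algebra_simps)
  have "(exp (M * T) - 1) *\<^sub>R C = G T - exp (M * T) *\<^sub>R G 0"
    using e by (simp add: C_def)
  then have "G T + C = exp (M * T) *\<^sub>R (G 0 + C)"
    by (simp add: algebra_simps)
  then have hT: "h T = h 0"
    by (simp add: h_def exp_minus)
  define D where "D = (\<lambda>t. exp (M * t) *\<^sub>R (h (t + T) - h t))"
  have "(D has_vector_derivative 0) (at t)" for t
    unfolding D_def
    by (rule derivative_eq_intros h' has_vector_derivative_periodic_shift | simp)+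
      (simp add: g(2)[of t] scaleR_right_diff_distrib mult.commute)
  then have "D t = D 0" for t
    by (rule zero_derivative_imp_const)
  then have "h (t + T) = h t" for t
    using hT by (simp add: D_def)
  then show ?thesis using that h' by blast
qed

section \<open>Periodic motions of contracting vector fields\<close>

text \<open>A time-periodic Lipschitz vector field on a Euclidean space that is uniformly dissipative for
  differences of solutions, measured by the inner product \<open>B\<close>.\<close>

locale contracting_field =
  fixes f :: "real \<Rightarrow> 'a \<Rightarrow> 'a::euclidean_space" and B :: "'a \<Rightarrow> 'a \<Rightarrow> real"
    and lo hi c L T :: real
  assumes bil: "bounded_bilinear B" and sym: "B u v = B v u"
    and lo: "lo > 0" "lo * (norm u)\<^sup>2 \<le> B u u" and hi: "B u u \<le> hi * (norm u)\<^sup>2"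
    and c: "c > 0" "B (z - w) (f t z - f t w) \<le> - c * (norm (z - w))\<^sup>2"
    and L: "norm (f t z - f t w) \<le> L * norm (z - w)"
    and cont: "continuous_on UNIV (\<lambda>(t, z). f t z)"
    and T: "T > 0" "f (t + T) z = f t z"
begin

sublocale B: bounded_bilinear B by (rule bil)

lemma continuous_along: "continuous_on UNIV (\<lambda>t. f t (z t))" if "continuous_on UNIV z"
proof -
  have "continuous_on UNIV (\<lambda>t. (t, z t))" by (intro continuous_intros that)
  from continuous_on_compose2[OF cont this] show ?thesis by simp
qed

lemma hi_pos: "hi > 0"
proof -
  obtain u :: 'a where u: "u \<in> Basis" using nonempty_Basis by blast
  have "lo * (norm u)\<^sup>2 \<le> hi * (norm u)\<^sup>2" using lo(2) hi by (rule order_trans)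
  then show ?thesis using lo(1) u by simp
qed

lemma B_nonneg: "B u u \<ge> 0"
  using lo(2)[of u] lo(1) by (smt (verit) mult_nonneg_nonneg zero_le_power2)

lemma B_derivative:
  assumes "(u has_vector_derivative u') (at t within S)"
  shows "((\<lambda>t. B (u t) (u t)) has_real_derivative (2 * B (u t) u')) (at t within S)"
  using B.has_vector_derivative[OF assms assms] sym[of u' "u t"]
  by (simp add: has_real_derivative_iff_has_vector_derivative)

lemma B_cauchy_schwarz: "(B u v)\<^sup>2 \<le> B u u * B v v"
proof (cases "v = 0")
  case False
  then have pos: "B v v > 0" using lo(1) lo(2)[of v] by (smt (verit) mult_pos_pos zero_less_norm_iff zero_less_power)
  have "0 \<le> B (B v v *\<^sub>R u - B u v *\<^sub>R v) (B v v *\<^sub>R u - B u v *\<^sub>R v)" by (rule B_nonneg)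
  also have "\<dots> = B v v * (B u u * B v v - (B u v)\<^sup>2)"
    by (simp add: B.diff_left B.diff_right B.scaleR_left B.scaleR_right sym[of v u]
        power2_eq_square algebra_simps)
  finally show ?thesis using pos by (simp add: zero_le_mult_iff)
qed (simp add: B.zero_left B.zero_right)

text \<open>Two solutions approach each other exponentially fast.\<close>

lemma solutions_attract:
  assumes z: "\<And>t. t \<ge> t0 \<Longrightarrow> (z has_vector_derivative f t (z t)) (at t within {t0..})"
    and w: "\<And>t. t \<ge> t0 \<Longrightarrow> (w has_vector_derivative f t (w t)) (at t within {t0..})"
    and t: "t0 \<le> t"
  shows "norm (z t - w t) \<le> sqrt (hi / lo) * exp (- (c / hi) * (t - t0)) * norm (z t0 - w t0)"
proof -
  define k where "k = c / hi"
  define V where "V = (\<lambda>t. B (z t - w t) (z t - w t))"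
  define E where "E = (\<lambda>t. exp (2 * k * (t - t0)) * V t)"
  have V': "(V has_real_derivative (2 * B (z t - w t) (f t (z t) - f t (w t)))) (at t within {t0..})"
    if "t \<ge> t0" for t
    unfolding V_def by (rule B_derivative) (intro has_vector_derivative_diff z w that)
  define E' where "E' = (\<lambda>t. exp (2 * k * (t - t0)) * (2 * k * V t + 2 * B (z t - w t) (f t (z t) - f t (w t))))"
  have E': "(E has_real_derivative E' t) (at t within {t0..})"
    if "t \<ge> t0" for t
    unfolding E_def E'_def
    by (rule derivative_eq_intros V' that | simp)+ (simp add: algebra_simps)
  have neg: "E' t \<le> 0" for t
  proof -
    have "k * V t \<le> k * (hi * (norm (z t - w t))\<^sup>2)"
      unfolding V_def k_def using hi hi_pos c(1) by (intro mult_left_mono) auto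
    also have "\<dots> = c * (norm (z t - w t))\<^sup>2" using hi_pos by (simp add: k_def)
    finally have "2 * k * V t + 2 * B (z t - w t) (f t (z t) - f t (w t)) \<le> 0"
      using c(2)[of "z t" "w t" t] by simp
    then show ?thesis unfolding E'_def by (simp add: mult_nonneg_nonpos)
  qed
  have "E t \<le> E t0"
  proof (cases "t = t0")
    case False
    show ?thesis
    proof (rule DERIV_nonpos_imp_decreasing_open[of t0 t E])
      show "t0 \<le> t" using t .
      show "\<exists>y. DERIV E x :> y \<and> y \<le> 0" if "t0 < x" "x < t" for x
      proof -
        have "at x within {t0..} = at x"
          using that by (intro at_within_interior) (simp add: interior_real_atLeast)
        then show ?thesis using E'[of x] neg[of x] that by auto
      qed
      show "continuous_on {t0..t} E"
      proof (rule continuous_on_subset)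
        show "continuous_on {t0..} E"
          by (rule DERIV_continuous_on[where D=E']) (use E' in auto)
      qed auto
    qed
  qed simp
  then have *: "exp (2 * k * (t - t0)) * V t \<le> V t0" by (simp add: E_def)
  have "lo * (norm (z t - w t))\<^sup>2 \<le> V t" unfolding V_def by (rule lo(2))
  also have "\<dots> = exp (- (2 * k * (t - t0))) * (exp (2 * k * (t - t0)) * V t)"
    by (simp flip: mult.assoc exp_add)
  also have "\<dots> \<le> exp (- (2 * k * (t - t0))) * V t0" using * by (intro mult_left_mono) auto
  also have "\<dots> \<le> exp (- (2 * k * (t - t0))) * (hi * (norm (z t0 - w t0))\<^sup>2)"
    unfolding V_def using hi by (intro mult_left_mono) auto
  finally have "(norm (z t - w t))\<^sup>2 \<le> (hi / lo) * exp (- (2 * k * (t - t0))) * (norm (z t0 - w t0))\<^sup>2"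
    using lo(1) by (simp add: field_simps)
  also have "exp (- (2 * k * (t - t0))) = (exp (- k * (t - t0)))\<^sup>2"
    by (simp add: power2_eq_square flip: exp_add)
  also have "hi / lo * (exp (- k * (t - t0)))\<^sup>2 * (norm (z t0 - w t0))\<^sup>2
      = (sqrt (hi / lo) * exp (- k * (t - t0)) * norm (z t0 - w t0))\<^sup>2"
    using lo(1) hi_pos by (simp add: power_mult_distrib)
  finally have "(norm (z t - w t))\<^sup>2 \<le> (sqrt (hi / lo) * exp (- k * (t - t0)) * norm (z t0 - w t0))\<^sup>2" .
  then show ?thesis unfolding k_def
    by (rule power2_le_imp_le) (use lo(1) hi_pos in auto)
qed

text \<open>At a maximum of \<open>B (u, u)\<close> along a periodic curve its derivative vanishes.\<close>

lemma periodic_B_max: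
  assumes u: "\<And>t. (u has_vector_derivative u' t) (at t)" "\<And>t. u (t + T) = u t"
  obtains m where "\<And>t. B (u t) (u t) \<le> B (u m) (u m)" "B (u m) (u' m) = 0"
proof -
  have D: "DERIV (\<lambda>t. B (u t) (u t)) t :> 2 * B (u t) (u' t)" for t
    by (rule B_derivative[OF u(1)])
  have "continuous_on UNIV (\<lambda>t. B (u t) (u t))"
    by (rule DERIV_continuous_on) (use D in auto)
  then obtain m where m: "\<And>t. B (u t) (u t) \<le> B (u m) (u m)"
    using periodic_attains_max[of "\<lambda>t. B (u t) (u t)" T] u(2) T(1) by metis
  have "2 * B (u m) (u' m) = 0"
    by (rule DERIV_local_max[OF D, of 1]) (use m in auto)
  then show ?thesis using that[OF m] by simp
qed

text \<open>A periodic curve that almost solves the equation is close to every periodic solution.\<close>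

lemma almost_solution_near:
  assumes z: "\<And>t. (z has_vector_derivative f t (z t)) (at t)" "\<And>t. z (t + T) = z t"
    and w: "\<And>t. (w has_vector_derivative w' t) (at t)" "\<And>t. w (t + T) = w t"
    and K: "\<And>u v. \<bar>B u v\<bar> \<le> norm u * norm v * K" "K \<ge> 0"
    and r: "\<And>t. norm (w' t - f t (w t)) \<le> r"
  shows "norm (z t - w t) \<le> sqrt (hi / lo) * (K * r / c)"
proof -
  define u where "u = (\<lambda>t. z t - w t)"
  have r0: "r \<ge> 0" using r[of 0] norm_ge_zero order_trans by blast
  obtain m where m: "\<And>t. B (u t) (u t) \<le> B (u m) (u m)" "B (u m) (f m (z m) - w' m) = 0"
    by (rule periodic_B_max[of u "\<lambda>t. f t (z t) - w' t"])
      (auto simp: u_def z w intro!: has_vector_derivative_diff)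
  have eq: "B (u m) (f m (z m) - w' m) = B (u m) (f m (z m) - f m (w m)) - B (u m) (w' m - f m (w m))"
    by (simp flip: B.diff_right)
  then have "0 \<le> - c * (norm (u m))\<^sup>2 + norm (u m) * r * K"
  proof -
    have "\<bar>B (u m) (w' m - f m (w m))\<bar> \<le> norm (u m) * norm (w' m - f m (w m)) * K" by (rule K)
    also have "\<dots> \<le> norm (u m) * r * K"
      using K(2) r by (intro mult_right_mono mult_left_mono) auto
    finally show ?thesis
      using c(2)[of "z m" "w m" m] m(2) eq unfolding u_def by linarith
  qed
  then have "norm (u m) * (c * norm (u m)) \<le> norm (u m) * (K * r)"
    by (simp add: power2_eq_square algebra_simps)
  then have um: "norm (u m) \<le> K * r / c"
    using c(1) K(2) r0 by (cases "norm (u m) = 0") (auto simp: field_simps)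
  have "lo * (norm (u t))\<^sup>2 \<le> B (u t) (u t)" by (rule lo(2))
  also have "\<dots> \<le> hi * (norm (u m))\<^sup>2" using m(1) hi order_trans by blast
  also have "\<dots> \<le> hi * (K * r / c)\<^sup>2"
    using um hi_pos by (intro mult_left_mono power_mono) auto
  finally have "(norm (u t))\<^sup>2 \<le> (sqrt (hi / lo) * (K * r / c))\<^sup>2"
    using lo(1) hi_pos unfolding power_mult_distrib[of "sqrt (hi / lo)"]
    by (simp add: pos_le_divide_eq mult.commute)
  then show ?thesis unfolding u_def
    by (rule power2_le_imp_le) (use lo(1) hi_pos K(2) r0 c(1) in auto)
qed

lemma periodic_solution_unique:
  assumes z: "\<And>t. (z has_vector_derivative f t (z t)) (at t)" "\<And>t. z (t + T) = z t"
    and w: "\<And>t. (w has_vector_derivative f t (w t)) (at t)" "\<And>t. w (t + T) = w t"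
  shows "z = w"
proof
  fix t
  obtain K where K: "K \<ge> 0" "\<And>u v. \<bar>B u v\<bar> \<le> norm u * norm v * K"
    using B.nonneg_bounded by (auto simp del: real_norm_def simp flip: real_norm_def)
  have "norm (z t - w t) \<le> sqrt (hi / lo) * (K * 0 / c)"
    by (rule almost_solution_near[OF z w K(2) K(1)]) simp
  then show "z t = w t" by simp
qed

text \<open>
  For large \<open>M\<close> the map \<open>z \<mapsto> (d/dt + M)\<^sup>-\<^sup>1 (f (t, z) + M z)\<close> on periodic functions contracts the
  supremum of \<open>B (u, u)\<close>: the one-sided bound in \<open>c\<close> makes \<open>z \<mapsto> f (t, z) + M z\<close> have a Lipschitz
  constant below \<open>M\<close>, and \<open>(d/dt + M)\<^sup>-\<^sup>1\<close> gains the factor \<open>1/M\<close> by the maximum principle. Its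
  fixed points are the periodic solutions, so no initial value problem has to be solved.
\<close>

lemma periodic_solution_exists:
  obtains z where "\<And>t. (z has_vector_derivative f t (z t)) (at t)" "\<And>t. z (t + T) = z t"
proof -
  define M where "M = hi * L\<^sup>2 / c + c / hi"
  define q where "q = 1 - c / (hi * M)"
  have Mpos: "M > 0" unfolding M_def using hi_pos c(1) by (intro add_nonneg_pos) auto
  have hiL: "hi * L\<^sup>2 \<le> M * c" and Mc: "c / hi \<le> M"
    unfolding M_def using hi_pos c(1) by (auto simp: field_simps)
  have q: "0 \<le> q" "q < 1"
    using Mc hi_pos c(1) Mpos by (auto simp: q_def field_simps)
  \<comment> \<open>the shifted field is Lipschitz in the norm of \<open>B\<close> with constant \<open>M sqrt q\<close>\<close>
  have step: "B (f t z - f t w + M *\<^sub>R (z - w)) (f t z - f t w + M *\<^sub>R (z - w)) \<le> q * M\<^sup>2 * B (z - w) (z - w)"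
    for t z w
  proof -
    define u F where "u = z - w" and "F = f t z - f t w"
    have "B F F \<le> hi * (norm F)\<^sup>2" by (rule hi)
    also have "\<dots> \<le> hi * (L * norm u)\<^sup>2"
      unfolding F_def u_def using L hi_pos by (intro mult_left_mono power_mono) auto
    also have "\<dots> = hi * L\<^sup>2 * (norm u)\<^sup>2" by (simp add: power_mult_distrib)
    also have "\<dots> \<le> M * c * (norm u)\<^sup>2" using hiL by (intro mult_right_mono) auto
    finally have FF: "B F F \<le> M * c * (norm u)\<^sup>2" .
    have "M * B u F \<le> M * (- c * (norm u)\<^sup>2)"
      unfolding u_def F_def using c(2) Mpos by (intro mult_left_mono) auto
    then have uF: "M * B u F \<le> - (M * c * (norm u)\<^sup>2)" by simp
    have "M * c * (B u u / hi) \<le> M * c * (norm u)\<^sup>2"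
      using hi[of u] hi_pos c(1) Mpos by (intro mult_left_mono) (auto simp: field_simps)
    moreover have "B (F + M *\<^sub>R u) (F + M *\<^sub>R u) = B F F + 2 * (M * B u F) + M\<^sup>2 * B u u"
      by (simp add: B.add_left B.add_right B.scaleR_left B.scaleR_right sym[of F u]
          power2_eq_square algebra_simps)
    ultimately have "B (F + M *\<^sub>R u) (F + M *\<^sub>R u) \<le> M\<^sup>2 * B u u - M * c * (B u u / hi)"
      using FF uF by linarith
    also have "\<dots> = q * M\<^sup>2 * B u u"
      using Mpos hi_pos by (simp add: q_def field_simps power2_eq_square)
    finally show ?thesis by (simp add: u_def F_def)
  qed
  define P where "P = {z :: real \<Rightarrow>\<^sub>C 'a. \<forall>t. z (t + T) = z t}"
  define is_image where "is_image = (\<lambda>(z :: real \<Rightarrow>\<^sub>C 'a) (h :: real \<Rightarrow>\<^sub>C 'a). h \<in> P \<and>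
    (\<forall>t. (h has_vector_derivative (f t (z t) + M *\<^sub>R z t - M *\<^sub>R h t)) (at t)))"
  define \<Phi> where "\<Phi> = (\<lambda>z. SOME h. is_image z h)"
  have \<Phi>: "is_image z (\<Phi> z)" if zP: "z \<in> P" for z
  proof -
    have g: "continuous_on UNIV (\<lambda>t. f t (z t) + M *\<^sub>R z t)"
      by (intro continuous_intros continuous_along) auto
    obtain h where h: "\<And>t. (h has_vector_derivative (f t (z t) + M *\<^sub>R z t - M *\<^sub>R h t)) (at t)"
      "\<And>t. h (t + T) = h t"
    proof (rule periodic_linear_ode_exists[OF g _ T(1) Mpos])
      show "f (t + T) (z (t + T)) + M *\<^sub>R z (t + T) = f t (z t) + M *\<^sub>R z t" for t
        using zP by (simp add: P_def T(2))
    qed blast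
    have hc: "continuous_on UNIV h"
      by (rule continuous_at_imp_continuous_on)
        (use h(1) has_vector_derivative_continuous in blast)
    obtain K where "\<And>t. norm (h t) \<le> K" using periodic_bounded[OF h(2) T(1) hc] by blast
    then have "h \<in> bcontfun" by (rule bcontfun_normI[OF hc])
    then have "is_image z (Bcontfun h)"
      by (simp add: is_image_def P_def Bcontfun_inverse h)
    then show ?thesis unfolding \<Phi>_def by (rule someI)
  qed
  have \<Phi>P: "\<Phi> z \<in> P" if "z \<in> P" for z using \<Phi>[OF that] by (simp add: is_image_def)
  have contr: "B (\<Phi> z t - \<Phi> w t) (\<Phi> z t - \<Phi> w t) \<le> q * S"
    if zw: "z \<in> P" "w \<in> P" and S: "\<And>t. B (z t - w t) (z t - w t) \<le> S" for z w S t
  proof -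
    define u where "u = (\<lambda>t. \<Phi> z t - \<Phi> w t)"
    define G where "G = (\<lambda>t. f t (z t) - f t (w t) + M *\<^sub>R (z t - w t))"
    have D: "(u has_vector_derivative (G t - M *\<^sub>R u t)) (at t)" for t
    proof -
      have "(u has_vector_derivative ((f t (z t) + M *\<^sub>R z t - M *\<^sub>R \<Phi> z t) -
        (f t (w t) + M *\<^sub>R w t - M *\<^sub>R \<Phi> w t))) (at t)"
        unfolding u_def using \<Phi> zw by (intro has_vector_derivative_diff) (auto simp: is_image_def)
      moreover have "(f t (z t) + M *\<^sub>R z t - M *\<^sub>R \<Phi> z t) - (f t (w t) + M *\<^sub>R w t - M *\<^sub>R \<Phi> w t)
        = G t - M *\<^sub>R u t" by (simp add: G_def u_def algebra_simps)
      ultimately show ?thesis by simp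
    qed
    have "u (t + T) = u t" for t
      using \<Phi>P zw by (simp add: u_def P_def)
    then obtain m where m: "\<And>t. B (u t) (u t) \<le> B (u m) (u m)" "B (u m) (G m - M *\<^sub>R u m) = 0"
      using periodic_B_max[of u "\<lambda>t. G t - M *\<^sub>R u t"] D by blast
    have "M * B (u m) (u m) = B (u m) (G m)"
      using m(2) by (simp add: B.diff_right B.scaleR_right)
    then have "(M * B (u m) (u m))\<^sup>2 \<le> B (u m) (u m) * B (G m) (G m)"
      using B_cauchy_schwarz[of "u m" "G m"] by simp
    also have "\<dots> \<le> B (u m) (u m) * (q * M\<^sup>2 * S)"
    proof (intro mult_left_mono B_nonneg)
      have "B (G m) (G m) \<le> q * M\<^sup>2 * B (z m - w m) (z m - w m)"
        unfolding G_def by (rule step)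
      also have "\<dots> \<le> q * M\<^sup>2 * S" using S q by (intro mult_left_mono) auto
      finally show "B (G m) (G m) \<le> q * M\<^sup>2 * S" .
    qed
    finally have "M\<^sup>2 * (B (u m) (u m) * B (u m) (u m)) \<le> M\<^sup>2 * (B (u m) (u m) * (q * S))"
      by (simp add: power2_eq_square algebra_simps)
    then have *: "B (u m) (u m) * B (u m) (u m) \<le> B (u m) (u m) * (q * S)"
      using Mpos by simp
    have "S \<ge> 0" using S[of 0] B_nonneg order_trans by blast
    then have "B (u m) (u m) \<le> q * S"
      using * B_nonneg[of "u m"] q(1) by (cases "B (u m) (u m) = 0") auto
    then show ?thesis using m(1)[of t] unfolding u_def by linarith
  qed
  have funpow: "(\<Phi> ^^ n) z \<in> P \<and> (\<Phi> ^^ n) w \<in> P \<and>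
      (\<forall>t. B ((\<Phi> ^^ n) z t - (\<Phi> ^^ n) w t) ((\<Phi> ^^ n) z t - (\<Phi> ^^ n) w t) \<le> q ^ n * (hi * (dist z w)\<^sup>2))"
    if "z \<in> P" "w \<in> P" for z w n
  proof (induction n)
    case 0
    have "B (z t - w t) (z t - w t) \<le> hi * (dist z w)\<^sup>2" for t
    proof -
      have "hi * (norm (z t - w t))\<^sup>2 \<le> hi * (dist z w)\<^sup>2"
        using hi_pos dist_bounded[of z t w]
        by (intro mult_left_mono power_mono) (auto simp: dist_norm)
      then show ?thesis using hi order_trans by blast
    qed
    then show ?case using that by simp
  next
    case (Suc n)
    then show ?case
      using \<Phi>P contr[of "(\<Phi> ^^ n) z" "(\<Phi> ^^ n) w" "q ^ n * (hi * (dist z w)\<^sup>2)"]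
      by (simp add: mult.assoc)
  qed
  \<comment> \<open>some iterate contracts the supremum norm itself\<close>
  have "(\<lambda>n. q ^ n * hi / lo) \<longlonglongrightarrow> 0 * hi / lo"
    using q by (intro tendsto_intros LIMSEQ_power_zero) (use lo(1) in auto)
  then have "\<forall>\<^sub>F n in sequentially. q ^ n * hi / lo < 1 / 4"
    by (rule order_tendstoD(2)) simp
  then obtain n where n: "q ^ n * hi / lo < 1 / 4"
    using eventually_happens'[OF sequentially_bot] by blast
  have dist_half: "dist ((\<Phi> ^^ n) z) ((\<Phi> ^^ n) w) \<le> 1 / 2 * dist z w" if "z \<in> P" "w \<in> P" for z w
  proof (rule dist_bound)
    fix t
    define d where "d = dist ((\<Phi> ^^ n) z t) ((\<Phi> ^^ n) w t)"
    have "lo * d\<^sup>2 \<le> B ((\<Phi> ^^ n) z t - (\<Phi> ^^ n) w t) ((\<Phi> ^^ n) z t - (\<Phi> ^^ n) w t)"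
      unfolding d_def dist_norm by (rule lo(2))
    also have "\<dots> \<le> q ^ n * (hi * (dist z w)\<^sup>2)"
      using funpow[OF that, of n] by blast
    finally have "lo * d\<^sup>2 \<le> q ^ n * (hi * (dist z w)\<^sup>2)" .
    then have "d\<^sup>2 \<le> q ^ n * hi / lo * (dist z w)\<^sup>2"
      using lo(1) by (simp add: field_simps)
    also have "\<dots> \<le> 1 / 4 * (dist z w)\<^sup>2"
      using n by (intro mult_right_mono) auto
    also have "\<dots> = (1 / 2 * dist z w)\<^sup>2" by (simp add: power_mult_distrib power2_eq_square)
    finally show "dist ((\<Phi> ^^ n) z t) ((\<Phi> ^^ n) w t) \<le> 1 / 2 * dist z w"
      unfolding d_def by (rule power2_le_imp_le) simp
  qed
  have "closed P"
  proof -
    have "P = (\<Inter>t. {z :: real \<Rightarrow>\<^sub>C 'a. z (t + T) = z t})" by (auto simp: P_def)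
    moreover have "closed {z :: real \<Rightarrow>\<^sub>C 'a. z (t + T) = z t}" for t
    proof (rule closed_Collect_eq)
      have "continuous_on UNIV (\<lambda>z :: real \<Rightarrow>\<^sub>C 'a. z s)" for s
        by (rule lipschitz_on_continuous_on[of 1]) (auto intro!: lipschitz_onI simp: dist_bounded)
      then show "continuous_on UNIV (\<lambda>z :: real \<Rightarrow>\<^sub>C 'a. z (t + T))"
        "continuous_on UNIV (\<lambda>z :: real \<Rightarrow>\<^sub>C 'a. z t)" by auto
    qed
    ultimately show ?thesis by auto
  qed
  then have "complete P" by (simp add: complete_eq_closed)
  moreover have "const_bcontfun 0 \<in> P" by (simp add: P_def)
  ultimately have "\<exists>!z. z \<in> P \<and> (\<Phi> ^^ n) z = z"
    using Banach_fix[of P "1 / 2" "\<Phi> ^^ n"] dist_half funpow by (auto simp: image_subset_iff)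
  then obtain z where z: "z \<in> P" "(\<Phi> ^^ n) z = z"
    and uniq: "\<And>w. w \<in> P \<Longrightarrow> (\<Phi> ^^ n) w = w \<Longrightarrow> w = z" by blast
  have "(\<Phi> ^^ n) (\<Phi> z) = \<Phi> z"
    using z(2) by (simp add: funpow_swap1[symmetric])
  then have "\<Phi> z = z" using uniq \<Phi>P z(1) by blast
  then have "(z has_vector_derivative f t (z t)) (at t)" for t
    using \<Phi>[OF z(1)] by (simp add: is_image_def)
  then show ?thesis using that z(1) by (auto simp: P_def)
qed

end

section \<open>Weakly perturbed conservative linear systems\<close>

text \<open>
  Here \<open>A\<close> preserves the energy \<open>H\<close>, while the first order term \<open>g\<close> together with the correction \<open>Q\<close>
  of the energy dissipates. If \<open>z0\<close> is a free periodic motion and the corrector equation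
  \<open>w' = A w + g (t, z0)\<close> has a periodic solution \<open>w0\<close>, then \<open>z0 + \<epsilon> w0\<close> solves the full equation up to
  \<open>O(\<epsilon>\<^sup>2)\<close>. The contraction rate is of order \<open>\<epsilon>\<close>, so the periodic solution is \<open>O(\<epsilon>)\<close>-close to \<open>z0\<close>.
\<close>

lemma weakly_perturbed_periodic:
  fixes A :: "'a::euclidean_space \<Rightarrow> 'a" and g :: "real \<Rightarrow> 'a \<Rightarrow> 'a" and R f :: "real \<Rightarrow> real \<Rightarrow> 'a \<Rightarrow> 'a"
  assumes A: "bounded_linear A"
    and H: "bounded_bilinear H" "\<And>u v. H u v = H v u" "h > 0" "\<And>u. h * (norm u)\<^sup>2 \<le> H u u"
    and Q: "bounded_bilinear Q" "\<And>u v. Q u v = Q v u"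
    and conservative: "\<And>u. H u (A u) = 0"
    and diss: "c > 0" "\<And>t z w. H (z - w) (g t z - g t w) + Q (z - w) (A (z - w)) \<le> - c * (norm (z - w))\<^sup>2"
    and g: "\<And>t z w. norm (g t z - g t w) \<le> Lg * norm (z - w)"
    and R: "\<And>\<epsilon> t z w. 0 < \<epsilon> \<Longrightarrow> \<epsilon> \<le> 1 \<Longrightarrow> norm (R \<epsilon> t z - R \<epsilon> t w) \<le> Lr * norm (z - w)"
      "\<And>\<epsilon> t. 0 < \<epsilon> \<Longrightarrow> \<epsilon> \<le> 1 \<Longrightarrow> norm (R \<epsilon> t 0) \<le> Cr"
    and f: "\<And>\<epsilon> t z. 0 < \<epsilon> \<Longrightarrow> \<epsilon> \<le> 1 \<Longrightarrow> f \<epsilon> t z = A z + \<epsilon> *\<^sub>R g t z + \<epsilon>\<^sup>2 *\<^sub>R R \<epsilon> t z"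
      "\<And>\<epsilon>. 0 < \<epsilon> \<Longrightarrow> \<epsilon> \<le> 1 \<Longrightarrow> continuous_on UNIV (\<lambda>(t, z). f \<epsilon> t z)"
      "\<And>\<epsilon> t z. 0 < \<epsilon> \<Longrightarrow> \<epsilon> \<le> 1 \<Longrightarrow> f \<epsilon> (t + T) z = f \<epsilon> t z"
    and T: "T > 0"
    and z0: "\<And>t. (z0 has_vector_derivative A (z0 t)) (at t)" "\<And>t. z0 (t + T) = z0 t"
    and w0: "\<And>t. (w0 has_vector_derivative (A (w0 t) + g t (z0 t))) (at t)" "\<And>t. w0 (t + T) = w0 t"
  obtains \<epsilon>0 C z where "\<epsilon>0 > 0" "C \<ge> 0"
    "\<And>\<epsilon> t. 0 < \<epsilon> \<Longrightarrow> \<epsilon> \<le> \<epsilon>0 \<Longrightarrow> (z \<epsilon> has_vector_derivative f \<epsilon> t (z \<epsilon> t)) (at t)"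
    "\<And>\<epsilon> t. 0 < \<epsilon> \<Longrightarrow> \<epsilon> \<le> \<epsilon>0 \<Longrightarrow> z \<epsilon> (t + T) = z \<epsilon> t"
    "\<And>\<epsilon> w. 0 < \<epsilon> \<Longrightarrow> \<epsilon> \<le> \<epsilon>0 \<Longrightarrow> (\<And>t. (w has_vector_derivative f \<epsilon> t (w t)) (at t)) \<Longrightarrow>
      (\<And>t. w (t + T) = w t) \<Longrightarrow> w = z \<epsilon>"
    "\<And>\<epsilon> t. 0 < \<epsilon> \<Longrightarrow> \<epsilon> \<le> \<epsilon>0 \<Longrightarrow> norm (z \<epsilon> t - z0 t) \<le> C * \<epsilon>"
    "\<And>\<epsilon>. 0 < \<epsilon> \<Longrightarrow> \<epsilon> \<le> \<epsilon>0 \<Longrightarrow> \<exists>K>0. \<exists>k>0. \<forall>t0 w.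
      (\<forall>t\<ge>t0. (w has_vector_derivative f \<epsilon> t (w t)) (at t within {t0..})) \<longrightarrow>
      (\<forall>t\<ge>t0. norm (w t - z \<epsilon> t) \<le> K * exp (- k * (t - t0)) * norm (w t0 - z \<epsilon> t0))"
proof -
  interpret A: bounded_linear A by (rule A)
  interpret H: bounded_bilinear H by (rule H(1))
  interpret Q: bounded_bilinear Q by (rule Q(1))
  obtain KA where KA: "KA \<ge> 0" "\<And>u. norm (A u) \<le> norm u * KA" using A.nonneg_bounded by blast
  obtain KH where KH: "KH > 0" "\<And>u v. \<bar>H u v\<bar> \<le> norm u * norm v * KH"
    using H.pos_bounded by auto
  obtain KQ where KQ: "KQ > 0" "\<And>u v. \<bar>Q u v\<bar> \<le> norm u * norm v * KQ"
    using Q.pos_bounded by auto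
  have continuous: "continuous_on UNIV u" if "\<And>t. (u has_vector_derivative u' t) (at t)"
    for u u' :: "real \<Rightarrow> 'a"
    using that has_vector_derivative_continuous continuous_at_imp_continuous_on by blast
  obtain K0 where K0: "K0 \<ge> 0" "\<And>t. norm (z0 t) \<le> K0"
    using periodic_bounded[OF z0(2) T continuous[OF z0(1)]] by blast
  obtain Kw where Kw: "Kw \<ge> 0" "\<And>t. norm (w0 t) \<le> Kw"
    using periodic_bounded[OF w0(2) T continuous[OF w0(1)]] by blast
  define L1 L2 where "L1 = max 0 Lg" and "L2 = max 0 Lr"
  have L1: "L1 \<ge> 0" "norm (g t z - g t w) \<le> L1 * norm (z - w)" for t z w
    unfolding L1_def by (simp, rule order_trans[OF g mult_right_mono]) auto
  have L2: "L2 \<ge> 0" "0 < \<epsilon> \<Longrightarrow> \<epsilon> \<le> 1 \<Longrightarrow> norm (R \<epsilon> t z - R \<epsilon> t w) \<le> L2 * norm (z - w)" for \<epsilon> t z w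
    unfolding L2_def by (simp, rule order_trans[OF R(1) mult_right_mono]) auto
  have Cr: "Cr \<ge> 0" using order_trans[OF norm_ge_zero R(2)[of 1 0]] by simp
  define N where "N = KH * L2 + KQ * L1 + KQ * L2"
  have N: "N \<ge> 0" using KH KQ L1(1) L2(1) by (simp add: N_def)
  define N2 where "N2 = L1 * Kw + L2 * (K0 + Kw) + Cr"
  have N2: "N2 \<ge> 0" using L1(1) L2(1) K0 Kw Cr by (simp add: N2_def)
  \<comment> \<open>small enough for \<open>H + \<epsilon> Q\<close> to stay definite and for the second order terms to cost at most half of the decay rate\<close>
  define \<epsilon>0 where "\<epsilon>0 = min 1 (min (h / (2 * KQ)) (c / (2 * (N + 1))))"
  have \<epsilon>0: "\<epsilon>0 > 0" using H(3) KQ N diss(1) by (auto simp: \<epsilon>0_def)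
  have \<epsilon>: "\<epsilon> \<le> 1" "\<epsilon> * KQ \<le> h / 2" "\<epsilon> * N \<le> c / 2" if "0 < \<epsilon>" "\<epsilon> \<le> \<epsilon>0" for \<epsilon>
  proof -
    have "\<epsilon> \<le> h / (2 * KQ)" "\<epsilon> \<le> c / (2 * (N + 1))" using that by (auto simp: \<epsilon>0_def)
    then show "\<epsilon> * KQ \<le> h / 2" "\<epsilon> * N \<le> c / 2"
      using KQ N that(1) by (auto simp: field_simps)
    show "\<epsilon> \<le> 1" using that by (simp add: \<epsilon>0_def)
  qed
  define B where "B = (\<lambda>\<epsilon> u v. H u v + \<epsilon> * Q u v)"
  define hi where "hi = KH + KQ"
  have Bbound: "\<bar>B \<epsilon> u v\<bar> \<le> norm u * norm v * hi" if "0 < \<epsilon>" "\<epsilon> \<le> 1" for \<epsilon> u v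
  proof -
    have "\<bar>B \<epsilon> u v\<bar> \<le> \<bar>H u v\<bar> + \<bar>\<epsilon> * Q u v\<bar>" unfolding B_def by (rule abs_triangle_ineq)
    also have "\<bar>\<epsilon> * Q u v\<bar> \<le> 1 * \<bar>Q u v\<bar>" using that unfolding abs_mult by (intro mult_right_mono) auto
    finally show ?thesis using KH(2)[of u v] KQ(2)[of u v] by (simp add: hi_def algebra_simps)
  qed
  have contracting: "contracting_field (f \<epsilon>) (B \<epsilon>) (h / 2) hi (\<epsilon> * c / 2) (KA + L1 + L2) T"
    if e: "0 < \<epsilon>" "\<epsilon> \<le> \<epsilon>0" for \<epsilon>
  proof (rule contracting_field.intro)
    note e' = \<epsilon>[OF e]
    have diff: "f \<epsilon> t z - f \<epsilon> t w = A (z - w) + \<epsilon> *\<^sub>R (g t z - g t w) + \<epsilon>\<^sup>2 *\<^sub>R (R \<epsilon> t z - R \<epsilon> t w)" for t z w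
      using e e' by (simp add: f(1) A.diff algebra_simps)
    show "bounded_bilinear (B \<epsilon>)"
    proof
      show "\<exists>K. \<forall>u v. norm (B \<epsilon> u v) \<le> norm u * norm v * K"
        using Bbound[OF e(1) e'(1)] by auto
    qed (simp_all add: B_def H.add_left H.add_right Q.add_left Q.add_right H.scaleR_left
        H.scaleR_right Q.scaleR_left Q.scaleR_right algebra_simps)
    show "B \<epsilon> u v = B \<epsilon> v u" for u v unfolding B_def using H(2) Q(2) by metis
    show "0 < h / 2" using H(3) by simp
    show "h / 2 * (norm u)\<^sup>2 \<le> B \<epsilon> u u" for u
    proof -
      have "\<epsilon> * \<bar>Q u u\<bar> \<le> \<epsilon> * (norm u * norm u * KQ)"
        using KQ(2) e(1) by (intro mult_left_mono) auto
      also have "\<dots> = (\<epsilon> * KQ) * (norm u)\<^sup>2" by (simp add: power2_eq_square)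
      also have "\<dots> \<le> h / 2 * (norm u)\<^sup>2" using e' by (intro mult_right_mono) auto
      finally have "\<bar>\<epsilon> * Q u u\<bar> \<le> h / 2 * (norm u)\<^sup>2" using e(1) by (simp add: abs_mult)
      then show ?thesis using H(4)[of u] unfolding B_def by (simp add: abs_le_iff)
    qed
    show "B \<epsilon> u u \<le> hi * (norm u)\<^sup>2" for u
      using Bbound[of \<epsilon> u u] e(1) e'(1) by (simp add: power2_eq_square mult.commute)
    show "0 < \<epsilon> * c / 2" using e diss(1) by simp
    show "B \<epsilon> (z - w) (f \<epsilon> t z - f \<epsilon> t w) \<le> - (\<epsilon> * c / 2) * (norm (z - w))\<^sup>2" for z w t
    proof -
      define u G D where "u = z - w" and "G = g t z - g t w" and "D = R \<epsilon> t z - R \<epsilon> t w"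
      define n where "n = (norm u)\<^sup>2"
      have G: "norm G \<le> L1 * norm u" and D: "norm D \<le> L2 * norm u"
        unfolding G_def D_def u_def using L1 L2 e(1) e'(1) by auto
      have bound: "\<bar>Y u v\<bar> \<le> K * L * n"
        if "\<And>u v. \<bar>Y u v\<bar> \<le> norm u * norm v * K" "K > 0" "norm v \<le> L * norm u" for Y K L v
      proof -
        have "norm u * norm v * K \<le> norm u * (L * norm u) * K"
          using that by (intro mult_right_mono mult_left_mono) auto
        then show ?thesis using that(1)[of u v] by (simp add: n_def power2_eq_square algebra_simps)
      qed
      have b: "H u D \<le> KH * L2 * n" "Q u G \<le> KQ * L1 * n" "Q u D \<le> KQ * L2 * n"
        using bound[OF KH(2) KH(1) D] bound[OF KQ(2) KQ(1) G] bound[OF KQ(2) KQ(1) D] by auto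
      have "\<epsilon> * Q u D \<le> \<epsilon> * (KQ * L2 * n)" using b(3) e(1) by (intro mult_left_mono) auto
      also have "\<dots> \<le> 1 * (KQ * L2 * n)"
        using e'(1) KQ L2(1) by (intro mult_right_mono) (auto simp: n_def)
      finally have "H u D + Q u G + \<epsilon> * Q u D \<le> N * n" using b by (simp add: N_def algebra_simps)
      then have "\<epsilon> * (\<epsilon> * (H u D + Q u G + \<epsilon> * Q u D)) \<le> \<epsilon> * (\<epsilon> * (N * n))"
        using e(1) by (intro mult_left_mono) auto
      also have "\<dots> \<le> \<epsilon> * (c / 2 * n)"
        using mult_right_mono[OF e'(3), of n] e(1) by (intro mult_left_mono) (auto simp: n_def mult.assoc)
      finally have 1: "\<epsilon> * (\<epsilon> * (H u D + Q u G + \<epsilon> * Q u D)) \<le> \<epsilon> * (c / 2 * n)" .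
      have 2: "\<epsilon> * (H u G + Q u (A u)) \<le> \<epsilon> * (- c * n)"
        using diss(2)[of z w t] e(1) unfolding u_def G_def n_def by (intro mult_left_mono) auto
      have "B \<epsilon> u (A u + \<epsilon> *\<^sub>R G + \<epsilon>\<^sup>2 *\<^sub>R D)
          = \<epsilon> * (H u G + Q u (A u)) + \<epsilon> * (\<epsilon> * (H u D + Q u G + \<epsilon> * Q u D))"
        by (simp add: B_def H.add_right Q.add_right H.scaleR_right Q.scaleR_right conservative
            power2_eq_square algebra_simps)
      also have "\<dots> \<le> - (\<epsilon> * c / 2) * n" using 1 2 by (simp add: algebra_simps)
      finally show ?thesis unfolding diff u_def G_def D_def n_def .
    qed
    show "norm (f \<epsilon> t z - f \<epsilon> t w) \<le> (KA + L1 + L2) * norm (z - w)" for t z w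
    proof -
      have "norm (f \<epsilon> t z - f \<epsilon> t w) \<le> norm (A (z - w)) + norm (\<epsilon> *\<^sub>R (g t z - g t w))
          + norm (\<epsilon>\<^sup>2 *\<^sub>R (R \<epsilon> t z - R \<epsilon> t w))"
        unfolding diff by (intro norm_triangle_le add_mono order_refl)
      also have "norm (\<epsilon> *\<^sub>R (g t z - g t w)) \<le> 1 * norm (g t z - g t w)"
        unfolding norm_scaleR using e e' by (intro mult_right_mono) auto
      also have "norm (\<epsilon>\<^sup>2 *\<^sub>R (R \<epsilon> t z - R \<epsilon> t w)) \<le> 1 * norm (R \<epsilon> t z - R \<epsilon> t w)"
        unfolding norm_scaleR using e e' by (intro mult_right_mono) (auto simp: power_le_one)
      finally show ?thesis
        using KA(2)[of "z - w"] L1(2)[of t z w] L2(2)[OF e(1) e'(1), of t z w] by (simp add: algebra_simps)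
    qed
    show "continuous_on UNIV (\<lambda>(t, z). f \<epsilon> t z)" by (rule f(2)[OF e(1) e'(1)])
    show "0 < T" by (rule T)
    show "f \<epsilon> (t + T) z = f \<epsilon> t z" for t z by (rule f(3)[OF e(1) e'(1)])
  qed
  have "\<exists>z. 0 < \<epsilon> \<longrightarrow> \<epsilon> \<le> \<epsilon>0 \<longrightarrow> (\<forall>t. (z has_vector_derivative f \<epsilon> t (z t)) (at t)) \<and> (\<forall>t. z (t + T) = z t)" for \<epsilon>
    using contracting_field.periodic_solution_exists[OF contracting, of \<epsilon>] by metis
  then obtain z where "\<And>\<epsilon>. 0 < \<epsilon> \<Longrightarrow> \<epsilon> \<le> \<epsilon>0 \<Longrightarrow>
      (\<forall>t. (z \<epsilon> has_vector_derivative f \<epsilon> t (z \<epsilon> t)) (at t)) \<and> (\<forall>t. z \<epsilon> (t + T) = z \<epsilon> t)"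
    by metis
  then have z: "(z \<epsilon> has_vector_derivative f \<epsilon> t (z \<epsilon> t)) (at t)" "z \<epsilon> (t + T) = z \<epsilon> t"
    if "0 < \<epsilon>" "\<epsilon> \<le> \<epsilon>0" for \<epsilon> t
    using that by blast+
  define C where "C = sqrt (hi / (h / 2)) * (hi * N2 / (c / 2)) + Kw"
  show thesis
  proof (rule that[of \<epsilon>0 C z])
    show "\<epsilon>0 > 0" by (rule \<epsilon>0)
    show "C \<ge> 0" unfolding C_def hi_def using KH KQ N2 H(3) diss(1) Kw by auto
    show "(z \<epsilon> has_vector_derivative f \<epsilon> t (z \<epsilon> t)) (at t)" "z \<epsilon> (t + T) = z \<epsilon> t"
      if "0 < \<epsilon>" "\<epsilon> \<le> \<epsilon>0" for \<epsilon> t by (rule z[OF that])+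
    show "w = z \<epsilon>" if "0 < \<epsilon>" "\<epsilon> \<le> \<epsilon>0" "\<And>t. (w has_vector_derivative f \<epsilon> t (w t)) (at t)"
      "\<And>t. w (t + T) = w t" for \<epsilon> w
      by (rule contracting_field.periodic_solution_unique[OF contracting[OF that(1,2)] that(3,4) z[OF that(1,2)]])
    show "norm (z \<epsilon> t - z0 t) \<le> C * \<epsilon>" if e: "0 < \<epsilon>" "\<epsilon> \<le> \<epsilon>0" for \<epsilon> t
    proof -
      note e' = \<epsilon>[OF e]
      define W where "W = (\<lambda>t. z0 t + \<epsilon> *\<^sub>R w0 t)"
      have "norm (A (z0 t) + \<epsilon> *\<^sub>R (A (w0 t) + g t (z0 t)) - f \<epsilon> t (W t)) \<le> \<epsilon>\<^sup>2 * N2" for t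
      proof -
        have "A (z0 t) + \<epsilon> *\<^sub>R (A (w0 t) + g t (z0 t)) - f \<epsilon> t (W t)
            = \<epsilon> *\<^sub>R (g t (z0 t) - g t (W t)) - \<epsilon>\<^sup>2 *\<^sub>R R \<epsilon> t (W t)"
          unfolding f(1)[OF e(1) e'(1)] by (simp add: W_def A.add A.scaleR algebra_simps)
        also have "norm \<dots> \<le> \<epsilon> * norm (g t (z0 t) - g t (W t)) + \<epsilon>\<^sup>2 * norm (R \<epsilon> t (W t))"
          using norm_triangle_ineq4[of "\<epsilon> *\<^sub>R (g t (z0 t) - g t (W t))" "\<epsilon>\<^sup>2 *\<^sub>R R \<epsilon> t (W t)"] e(1) by simp
        also have "\<dots> \<le> \<epsilon> * (L1 * (\<epsilon> * Kw)) + \<epsilon>\<^sup>2 * (L2 * (K0 + Kw) + Cr)"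
        proof (intro add_mono mult_left_mono)
          have "norm (g t (z0 t) - g t (W t)) \<le> L1 * (\<epsilon> * norm (w0 t))"
            using L1(2)[of t "z0 t" "W t"] e(1) by (simp add: W_def)
          also have "\<dots> \<le> L1 * (\<epsilon> * Kw)" using Kw L1(1) e(1) by (intro mult_left_mono) auto
          finally show "norm (g t (z0 t) - g t (W t)) \<le> L1 * (\<epsilon> * Kw)" .
          have "norm (W t) \<le> norm (z0 t) + \<epsilon> * norm (w0 t)"
            unfolding W_def using norm_triangle_ineq[of "z0 t" "\<epsilon> *\<^sub>R w0 t"] e(1) by simp
          also have "\<dots> \<le> K0 + 1 * Kw" using K0 Kw e e' by (intro add_mono mult_mono) auto
          finally have "norm (W t) \<le> K0 + Kw" by simp
          then have "L2 * norm (W t) \<le> L2 * (K0 + Kw)" using L2(1) by (rule mult_left_mono)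
          then show "norm (R \<epsilon> t (W t)) \<le> L2 * (K0 + Kw) + Cr"
            using norm_triangle_sub[of "R \<epsilon> t (W t)" "R \<epsilon> t 0"] L2(2)[OF e(1) e'(1), of t "W t" 0]
              R(2)[OF e(1) e'(1), of t] by simp
        qed (use e in auto)
        also have "\<dots> = \<epsilon>\<^sup>2 * N2" by (simp add: N2_def power2_eq_square algebra_simps)
        finally show ?thesis .
      qed
      note residual = this
      have W: "(W has_vector_derivative (A (z0 t) + \<epsilon> *\<^sub>R (A (w0 t) + g t (z0 t)))) (at t)"
        "W (t + T) = W t" for t
        unfolding W_def by (rule derivative_eq_intros z0 w0 | simp add: z0(2) w0(2))+
      have "norm (z \<epsilon> t - W t) \<le> sqrt (hi / (h / 2)) * (hi * (\<epsilon>\<^sup>2 * N2) / (\<epsilon> * c / 2))"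
        by (rule contracting_field.almost_solution_near[OF contracting[OF e] z[OF e] W _ _ residual])
          (use e e' Bbound KH KQ in \<open>auto simp: hi_def\<close>)
      also have "\<dots> = \<epsilon> * (sqrt (hi / (h / 2)) * (hi * N2 / (c / 2)))"
        using e(1) by (simp add: power2_eq_square)
      finally have 1: "norm (z \<epsilon> t - W t) \<le> \<epsilon> * (sqrt (hi / (h / 2)) * (hi * N2 / (c / 2)))" .
      have "norm (z \<epsilon> t - z0 t) \<le> norm (z \<epsilon> t - W t) + norm (W t - z0 t)"
        using norm_triangle_ineq[of "z \<epsilon> t - W t" "W t - z0 t"] by simp
      also have "norm (W t - z0 t) \<le> \<epsilon> * Kw" using e(1) Kw by (simp add: W_def)
      finally show ?thesis using 1 by (simp add: C_def algebra_simps)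
    qed
    show "\<exists>K>0. \<exists>k>0. \<forall>t0 w.
      (\<forall>t\<ge>t0. (w has_vector_derivative f \<epsilon> t (w t)) (at t within {t0..})) \<longrightarrow>
      (\<forall>t\<ge>t0. norm (w t - z \<epsilon> t) \<le> K * exp (- k * (t - t0)) * norm (w t0 - z \<epsilon> t0))"
      if e: "0 < \<epsilon>" "\<epsilon> \<le> \<epsilon>0" for \<epsilon>
    proof (intro exI conjI allI impI)
      show "sqrt (hi / (h / 2)) > 0" "\<epsilon> * c / 2 / hi > 0" unfolding hi_def using KH KQ H(3) e(1) diss(1) by auto
      fix t0 w t assume "\<forall>t\<ge>t0. (w has_vector_derivative f \<epsilon> t (w t)) (at t within {t0..})" "t0 \<le> t"
      then show "norm (w t - z \<epsilon> t) \<le> sqrt (hi / (h / 2)) * exp (- (\<epsilon> * c / 2 / hi) * (t - t0)) * norm (w t0 - z \<epsilon> t0)"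
        by (intro contracting_field.solutions_attract[OF contracting[OF e]])
          (auto intro: has_vector_derivative_at_within z[OF e])
    qed
  qed
qed

section \<open>Resonance and averaging\<close>

text \<open>Variation of constants; the two integral conditions express the absence of resonance.\<close>

lemma oscillator_periodic_response:
  fixes h :: "real \<Rightarrow> real"
  assumes h: "continuous_on UNIV h" "\<And>t. h (t + T) = h t" and T: "T > 0"
    and \<nu>: "\<nu> \<noteq> 0" "\<nu> * T = 2 * pi * of_int n"
    and res: "((\<lambda>t. h t * cos (\<nu> * t)) has_integral 0) {0..T}" "((\<lambda>t. h t * sin (\<nu> * t)) has_integral 0) {0..T}"
  obtains q v where "\<And>t. (q has_vector_derivative v t) (at t)"
    "\<And>t. (v has_vector_derivative (h t - \<nu>\<^sup>2 * q t)) (at t)" "\<And>t. q (t + T) = q t" "\<And>t. v (t + T) = v t"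
proof -
  have per: "sin (\<nu> * (t + T)) = sin (\<nu> * t)" "cos (\<nu> * (t + T)) = cos (\<nu> * t)" for t
    using \<nu>(2) sin_add[of "\<nu> * t" "\<nu> * T"] cos_add[of "\<nu> * t" "\<nu> * T"]
      cos_int_2pin[of n] sin_int_2pin[of n]
    by (simp_all add: distrib_left mult_ac)
  obtain U where U: "\<And>t. (U has_vector_derivative h t * cos (\<nu> * t)) (at t)" "\<And>t. U (t + T) = U t"
    by (rule periodic_antiderivative_exists[OF _ _ T res(1)]) (auto intro!: continuous_intros h simp: h per)
  obtain V where V: "\<And>t. (V has_vector_derivative h t * sin (\<nu> * t)) (at t)" "\<And>t. V (t + T) = V t"
    by (rule periodic_antiderivative_exists[OF _ _ T res(2)]) (auto intro!: continuous_intros h simp: h per)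
  note UV = U(1)[folded has_real_derivative_iff_has_vector_derivative]
    V(1)[folded has_real_derivative_iff_has_vector_derivative]
  define q where "q = (\<lambda>t. (sin (\<nu> * t) * U t - cos (\<nu> * t) * V t) / \<nu>)"
  define v where "v = (\<lambda>t. cos (\<nu> * t) * U t + sin (\<nu> * t) * V t)"
  have "(q has_real_derivative v t) (at t)" for t
    unfolding q_def v_def using \<nu>(1)
    by (auto intro!: derivative_eq_intros UV simp: field_simps)
  moreover have "(v has_real_derivative (h t - \<nu>\<^sup>2 * q t)) (at t)" for t
  proof -
    have "h t = h t * ((cos (\<nu> * t))\<^sup>2 + (sin (\<nu> * t))\<^sup>2)" by simp
    then have *: "h t = h t * cos (\<nu> * t) * cos (\<nu> * t) + h t * sin (\<nu> * t) * sin (\<nu> * t)"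
      by (simp only: power2_eq_square distrib_left mult.assoc)
    have "(v has_real_derivative (- (sin (\<nu> * t) * \<nu>) * U t + cos (\<nu> * t) * (h t * cos (\<nu> * t))
        + (cos (\<nu> * t) * \<nu> * V t + sin (\<nu> * t) * (h t * sin (\<nu> * t))))) (at t)"
      unfolding v_def by (auto intro!: derivative_eq_intros UV simp: algebra_simps)
    also have "- (sin (\<nu> * t) * \<nu>) * U t + cos (\<nu> * t) * (h t * cos (\<nu> * t))
        + (cos (\<nu> * t) * \<nu> * V t + sin (\<nu> * t) * (h t * sin (\<nu> * t))) = h t - \<nu>\<^sup>2 * q t"
      using \<nu>(1) by (subst (3) *) (simp add: q_def power2_eq_square field_simps)
    finally show ?thesis .
  qed
  moreover have "q (t + T) = q t" "v (t + T) = v t" for t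
    by (simp_all add: q_def v_def per U V)
  ultimately show ?thesis
    unfolding has_real_derivative_iff_has_vector_derivative by (rule that)
qed

lemma has_integral_trig_multiple:
  fixes n :: int
  assumes T: "\<omega> * T = 2 * pi" "\<omega> > 0"
  shows "((\<lambda>t. cos (of_int n * \<omega> * t)) has_integral (if n = 0 then T else 0)) {0..T}"
    "((\<lambda>t. sin (of_int n * \<omega> * t)) has_integral 0) {0..T}"
proof -
  have T0: "T \<ge> 0" using T pi_gt_zero by (smt (verit) mult_pos_neg)
  have e: "of_int n * \<omega> * T = 2 * pi * of_int n" using T by simp
  show "((\<lambda>t. cos (of_int n * \<omega> * t)) has_integral (if n = 0 then T else 0)) {0..T}"
  proof (cases "n = 0")
    case True
    then show ?thesis using has_integral_const_real[of "1::real" 0 T] T0 by simp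
  next
    case False
    have "((\<lambda>t. cos (of_int n * \<omega> * t)) has_integral
        (sin (of_int n * \<omega> * T) / (of_int n * \<omega>) - sin (of_int n * \<omega> * 0) / (of_int n * \<omega>))) {0..T}"
      by (rule fundamental_theorem_of_calculus[OF T0])
        (use False T in \<open>auto intro!: derivative_eq_intros simp flip: has_real_derivative_iff_has_vector_derivative\<close>)
    then show ?thesis using False unfolding e by simp
  qed
  show "((\<lambda>t. sin (of_int n * \<omega> * t)) has_integral 0) {0..T}"
  proof (cases "n = 0")
    case False
    have "((\<lambda>t. sin (of_int n * \<omega> * t)) has_integral
        (- cos (of_int n * \<omega> * T) / (of_int n * \<omega>) - - cos (of_int n * \<omega> * 0) / (of_int n * \<omega>))) {0..T}"
      by (rule fundamental_theorem_of_calculus[OF T0])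
        (use False T in \<open>auto intro!: derivative_eq_intros simp flip: has_real_derivative_iff_has_vector_derivative\<close>)
    then show ?thesis unfolding e by simp
  qed simp
qed

lemma trig_polynomial_coefficients:
  fixes a1 b1 a2 b2 :: real
  assumes T: "\<omega> * T = 2 * pi" "\<omega> > 0"
  defines "h \<equiv> (\<lambda>t. a1 * sin (\<omega> * t) + b1 * cos (\<omega> * t) + a2 * sin (2 * \<omega> * t) + b2 * cos (2 * \<omega> * t))"
  shows "((\<lambda>t. h t * sin (\<omega> * t)) has_integral (T / 2 * a1)) {0..T}"
    "((\<lambda>t. h t * cos (\<omega> * t)) has_integral (T / 2 * b1)) {0..T}"
    "((\<lambda>t. h t * sin (2 * \<omega> * t)) has_integral (T / 2 * a2)) {0..T}"
    "((\<lambda>t. h t * cos (2 * \<omega> * t)) has_integral (T / 2 * b2)) {0..T}"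
proof -
  define S C where "S = (\<lambda>n t. sin (of_int n * \<omega> * t))" and "C = (\<lambda>n t. cos (of_int n * \<omega> * t))"
  have prods: "S m t * S n t = (C (m - n) t - C (m + n) t) / 2"
    "S m t * C n t = (S (m + n) t + S (m - n) t) / 2"
    "C m t * S n t = (S (m + n) t - S (m - n) t) / 2"
    "C m t * C n t = (C (m - n) t + C (m + n) t) / 2" for m n t
    unfolding S_def C_def sin_times_sin sin_times_cos cos_times_sin cos_times_cos
    by (simp_all add: algebra_simps)
  have I: "(C n has_integral (if n = 0 then T else 0)) {0..T}" "(S n has_integral 0) {0..T}" for n
    using has_integral_trig_multiple[OF T, of n] by (simp_all add: S_def C_def)
  have h: "h = (\<lambda>t. a1 * S 1 t + b1 * C 1 t + a2 * S 2 t + b2 * C 2 t)"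
    by (simp add: h_def S_def C_def)
  have S: "((\<lambda>t. h t * S n t) has_integral (a1 * (((if 1 - n = 0 then T else 0) - (if 1 + n = 0 then T else 0)) / 2)
      + b1 * ((0 - 0) / 2) + a2 * (((if 2 - n = 0 then T else 0) - (if 2 + n = 0 then T else 0)) / 2)
      + b2 * ((0 - 0) / 2))) {0..T}" for n
    unfolding h distrib_right mult.assoc prods
    by (intro has_integral_add has_integral_mult_right has_integral_divide has_integral_diff I)
  have C: "((\<lambda>t. h t * C n t) has_integral (a1 * ((0 + 0) / 2)
      + b1 * (((if 1 - n = 0 then T else 0) + (if 1 + n = 0 then T else 0)) / 2) + a2 * ((0 + 0) / 2)
      + b2 * (((if 2 - n = 0 then T else 0) + (if 2 + n = 0 then T else 0)) / 2))) {0..T}" for n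
    unfolding h distrib_right mult.assoc prods
    by (intro has_integral_add has_integral_mult_right has_integral_divide I)
  show "((\<lambda>t. h t * sin (\<omega> * t)) has_integral (T / 2 * a1)) {0..T}"
    using S[of 1] by (simp add: S_def mult_ac)
  show "((\<lambda>t. h t * sin (2 * \<omega> * t)) has_integral (T / 2 * a2)) {0..T}"
    using S[of 2] by (simp add: S_def mult_ac)
  show "((\<lambda>t. h t * cos (\<omega> * t)) has_integral (T / 2 * b1)) {0..T}"
    using C[of 1] by (simp add: C_def mult_ac)
  show "((\<lambda>t. h t * cos (2 * \<omega> * t)) has_integral (T / 2 * b2)) {0..T}"
    using C[of 2] by (simp add: C_def mult_ac)
qed

lemma DERIV_mult_pos_part: "((\<lambda>x::real. x * max 0 x) has_real_derivative 2 * max 0 x) (at x)"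
proof (cases x "0::real" rule: linorder_cases)
  case less
  have "((\<lambda>x::real. 0) has_real_derivative 0) (at x)" by simp
  then have "((\<lambda>x::real. x * max 0 x) has_real_derivative 0) (at x)"
    by (rule has_field_derivative_transform_within_open[where S="{..<0}"]) (use less in auto)
  then show ?thesis using less by simp
next
  case greater
  have "((\<lambda>x::real. x * x) has_real_derivative 2 * x) (at x)"
    by (auto intro!: derivative_eq_intros)
  then have "((\<lambda>x::real. x * max 0 x) has_real_derivative 2 * x) (at x)"
    by (rule has_field_derivative_transform_within_open[where S="{0<..}"]) (use greater in auto)
  then show ?thesis using greater by simp
next
  case equal
  have "((\<lambda>h::real. max 0 h) \<longlongrightarrow> max 0 0) (at 0)" by (intro tendsto_intros)
  then have "((\<lambda>h::real. max 0 h) \<longlongrightarrow> 0) (at 0)" by simp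
  then have "((\<lambda>h::real. (0 + h) * max 0 (0 + h) / h) \<longlongrightarrow> 0) (at 0)"
    by (rule Lim_transform_eventually) (auto simp: eventually_at_filter)
  then show ?thesis using equal by (simp add: DERIV_def)
qed

text \<open>
  With \<open>d\<close> the motion and \<open>e\<close> its quadrature component, \<open>(e d max 0 d)' = \<omega> max 0 d (2 e\<^sup>2 - d\<^sup>2)\<close>
  has mean zero; if also the second harmonic of \<open>max 0 d\<close> vanished, so would the mean of
  \<open>max 0 d (d\<^sup>2 - e\<^sup>2)\<close>, whence \<open>max 0 d = 0\<close>.
\<close>

lemma half_wave_second_harmonic:
  fixes a b :: real
  assumes T: "\<omega> * T = 2 * pi" "\<omega> > 0"
  defines "p \<equiv> (\<lambda>t. max 0 (a * sin (\<omega> * t) + b * cos (\<omega> * t)))"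
  assumes I: "((\<lambda>t. p t * sin (2 * \<omega> * t)) has_integral 0) {0..T}"
    "((\<lambda>t. p t * cos (2 * \<omega> * t)) has_integral 0) {0..T}"
  shows "a = 0 \<and> b = 0"
proof -
  define d where "d = (\<lambda>t. a * sin (\<omega> * t) + b * cos (\<omega> * t))"
  define e where "e = (\<lambda>t. a * cos (\<omega> * t) - b * sin (\<omega> * t))"
  have Tpos: "T > 0" using T pi_gt_zero by (metis mult_pos_pos pi_gt_zero zero_less_mult_pos zero_less_numeral)
  have p: "p t = max 0 (d t)" for t by (simp add: p_def d_def)
  have d': "(d has_real_derivative (\<omega> * e t)) (at t)" for t
    unfolding d_def e_def by (auto intro!: derivative_eq_intros simp: algebra_simps)
  have e': "(e has_real_derivative (- \<omega> * d t)) (at t)" for t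
    unfolding d_def e_def by (auto intro!: derivative_eq_intros simp: algebra_simps)
  have "((\<lambda>t. e t * (d t * max 0 (d t))) has_real_derivative (\<omega> * (p t * (2 * (e t)\<^sup>2 - (d t)\<^sup>2)))) (at t)" for t
    using DERIV_mult[OF e'[of t] DERIV_chain2[OF DERIV_mult_pos_part d'[of t]]]
    by (simp add: p power2_eq_square algebra_simps)
  then have "((\<lambda>t. \<omega> * (p t * (2 * (e t)\<^sup>2 - (d t)\<^sup>2))) has_integral
      (e T * (d T * max 0 (d T)) - e 0 * (d 0 * max 0 (d 0)))) {0..T}"
    by (intro fundamental_theorem_of_calculus)
      (use Tpos in \<open>auto simp: has_real_derivative_iff_has_vector_derivative intro: has_vector_derivative_at_within\<close>)
  moreover have "e T = e 0" "d T = d 0" using T by (simp_all add: e_def d_def)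
  ultimately have "((\<lambda>t. \<omega> * (p t * (2 * (e t)\<^sup>2 - (d t)\<^sup>2))) has_integral 0) {0..T}" by simp
  from has_integral_mult_right[OF this, of "1 / \<omega>"]
  have 1: "((\<lambda>t. p t * (2 * (e t)\<^sup>2 - (d t)\<^sup>2)) has_integral 0) {0..T}"
    using T(2) by (simp add: mult.assoc[symmetric])
  have 2: "((\<lambda>t. p t * ((d t)\<^sup>2 - (e t)\<^sup>2)) has_integral 0) {0..T}"
  proof -
    have "((\<lambda>t. 2 * a * b * (p t * sin (2 * \<omega> * t)) + (b\<^sup>2 - a\<^sup>2) * (p t * cos (2 * \<omega> * t))) has_integral
        (2 * a * b * 0 + (b\<^sup>2 - a\<^sup>2) * 0)) {0..T}"
      by (intro has_integral_add has_integral_mult_right I)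
    moreover have "2 * a * b * (p t * sin (2 * \<omega> * t)) + (b\<^sup>2 - a\<^sup>2) * (p t * cos (2 * \<omega> * t))
        = p t * ((d t)\<^sup>2 - (e t)\<^sup>2)" for t
      using sin_double[of "\<omega> * t"] cos_double[of "\<omega> * t"]
      by (simp add: d_def e_def mult.assoc power2_eq_square) (simp add: algebra_simps)
    ultimately show ?thesis by simp
  qed
  have "((\<lambda>t. p t * (2 * (e t)\<^sup>2 - (d t)\<^sup>2) + 2 * (p t * ((d t)\<^sup>2 - (e t)\<^sup>2))) has_integral (0 + 2 * 0)) {0..T}"
    by (intro has_integral_add has_integral_mult_right 1 2)
  then have 3: "((\<lambda>t. p t * (d t)\<^sup>2) has_integral 0) {0..T}"
    by (simp add: algebra_simps)
  have cont: "continuous_on {0..T} (\<lambda>t. p t * (d t)\<^sup>2)"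
    unfolding p d_def by (intro continuous_intros)
  have "integral {0..T} (\<lambda>t. p t * (d t)\<^sup>2) = 0" using 3 by (rule integral_unique)
  then have z: "p t * (d t)\<^sup>2 = 0" if "t \<in> {0..T}" for t
    using integral_eq_0_iff[OF cont Tpos] that by (simp add: p)
  have neg: "d t \<le> 0" if "t \<in> {0..T}" for t
    using z[OF that] by (auto simp: p max_def split: if_splits)
  have T4: "\<omega> * T / 4 = pi / 2" "\<omega> * T / 2 = pi" "\<omega> * (3 * T) / 4 = 3 / 2 * pi" using T(1) by simp_all
  have "b \<le> 0" using neg[of 0] Tpos by (simp add: d_def)
  moreover have "b \<ge> 0" using neg[of "T / 2"] Tpos by (simp add: d_def T4(2))
  moreover have "a \<le> 0" using neg[of "T / 4"] Tpos by (simp add: d_def T4(1))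
  moreover have "a \<ge> 0" using neg[of "3 * T / 4"] Tpos sin_3over2_pi cos_3over2_pi by (simp add: d_def T4(3))
  ultimately show ?thesis by simp
qed

text \<open>A Lipschitz perturbation of a constant map has a fixed point close to the constant.\<close>

lemma perturbed_fixed_point:
  fixes \<Psi> :: "'a::banach \<Rightarrow> 'a" and a0 :: 'a
  assumes \<Psi>: "K-lipschitz_on UNIV \<Psi>"
  obtains \<delta> a where "\<delta> > 0" "\<And>k. 0 < k \<Longrightarrow> k \<le> \<delta> \<Longrightarrow> a k = a0 + k *\<^sub>R \<Psi> (a k)" "(a \<longlongrightarrow> a0) (at_right 0)"
proof -
  have K: "K \<ge> 0" using \<Psi> by (rule lipschitz_on_nonneg)
  have lip: "norm (\<Psi> x - \<Psi> y) \<le> K * norm (x - y)" for x y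
    using lipschitz_onD[OF \<Psi>, of x y] by (simp add: dist_norm)
  define \<delta> where "\<delta> = 1 / (2 * (K + 1))"
  have \<delta>: "\<delta> > 0" using K by (simp add: \<delta>_def)
  have kK: "k * K \<le> 1 / 2" if "0 < k" "k \<le> \<delta>" for k
  proof -
    have "k * K \<le> \<delta> * (K + 1)" using that K by (intro mult_mono) auto
    also have "\<dots> = 1 / 2" using K by (simp add: \<delta>_def)
    finally show ?thesis .
  qed
  have "\<exists>x. 0 < k \<longrightarrow> k \<le> \<delta> \<longrightarrow> x = a0 + k *\<^sub>R \<Psi> x" for k
  proof (cases "0 < k \<and> k \<le> \<delta>")
    case True
    have "dist (a0 + k *\<^sub>R \<Psi> x) (a0 + k *\<^sub>R \<Psi> y) \<le> 1 / 2 * dist x y" for x y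
    proof -
      have "dist (a0 + k *\<^sub>R \<Psi> x) (a0 + k *\<^sub>R \<Psi> y) = k * norm (\<Psi> x - \<Psi> y)"
        using True by (simp add: dist_norm flip: scaleR_diff_right)
      also have "\<dots> \<le> k * (K * norm (x - y))" using lip True by (intro mult_left_mono) auto
      also have "\<dots> \<le> 1 / 2 * dist x y"
        using mult_right_mono[OF kK, of k "norm (x - y)"] True by (simp add: dist_norm mult.assoc)
      finally show ?thesis .
    qed
    then obtain x where "a0 + k *\<^sub>R \<Psi> x = x"
      using banach_fix_type[of "1 / 2" "\<lambda>x. a0 + k *\<^sub>R \<Psi> x"] by auto
    then show ?thesis by metis
  qed auto
  then obtain a where a: "\<And>k. 0 < k \<Longrightarrow> k \<le> \<delta> \<Longrightarrow> a k = a0 + k *\<^sub>R \<Psi> (a k)" by metis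
  have bound: "norm (a k - a0) \<le> k * (2 * norm (\<Psi> a0))" if k: "0 < k" "k \<le> \<delta>" for k
  proof -
    have "norm (a k - a0) = k * norm (\<Psi> (a k))" using a[OF k] k by (metis add_diff_cancel_left' norm_scaleR abs_of_pos)
    also have "\<dots> \<le> k * (norm (\<Psi> a0) + K * norm (a k - a0))"
      using norm_triangle_sub[of "\<Psi> (a k)" "\<Psi> a0"] lip[of "a k" a0] k by (intro mult_left_mono) auto
    also have "\<dots> \<le> k * norm (\<Psi> a0) + 1 / 2 * norm (a k - a0)"
      using mult_right_mono[OF kK[OF k], of "norm (a k - a0)"] by (simp add: algebra_simps)
    finally show ?thesis by simp
  qed
  have "((\<lambda>k. k * (2 * norm (\<Psi> a0))) \<longlongrightarrow> 0 * (2 * norm (\<Psi> a0))) (at_right 0)"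
    by (intro tendsto_intros)
  then have "((\<lambda>k. k * (2 * norm (\<Psi> a0))) \<longlongrightarrow> 0) (at_right 0)" by simp
  moreover have "\<forall>\<^sub>F k in at_right 0. norm (a k - a0) \<le> k * (2 * norm (\<Psi> a0))"
    using eventually_at_right_real[OF \<delta>] by eventually_elim (use bound in auto)
  ultimately have "((\<lambda>k. a k - a0) \<longlongrightarrow> 0) (at_right 0)"
    by (rule Lim_null_comparison[rotated])
  then have "(a \<longlongrightarrow> a0) (at_right 0)" using Lim_null by blast
  then show ?thesis using that[OF \<delta> a] by blast
qed

section \<open>The screen as a weakly perturbed system\<close>

lemma norm_state: "(norm (a, b, c, d :: real))\<^sup>2 = a\<^sup>2 + b\<^sup>2 + c\<^sup>2 + d\<^sup>2" for a b c :: real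
  by (simp add: norm_Pair add.assoc)

lemma abs_le_norm_state:
  "\<bar>a\<bar> \<le> norm (a, b, c, d :: real)" "\<bar>b\<bar> \<le> norm (a, b, c, d)"
  "\<bar>c\<bar> \<le> norm (a, b, c, d)" "\<bar>d\<bar> \<le> norm (a, b, c, d)" for a b c :: real
proof -
  have "a\<^sup>2 \<le> (norm (a, b, c, d))\<^sup>2" "b\<^sup>2 \<le> (norm (a, b, c, d))\<^sup>2"
    "c\<^sup>2 \<le> (norm (a, b, c, d))\<^sup>2" "d\<^sup>2 \<le> (norm (a, b, c, d))\<^sup>2"
    unfolding norm_state by simp_all
  then show "\<bar>a\<bar> \<le> norm (a, b, c, d)" "\<bar>b\<bar> \<le> norm (a, b, c, d)"
    "\<bar>c\<bar> \<le> norm (a, b, c, d)" "\<bar>d\<bar> \<le> norm (a, b, c, d)"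
    by (metis norm_ge_zero power2_abs power2_le_imp_le)+
qed

text \<open>The penetration depth into the one-sided stop.\<close>

definition penetration :: "state \<Rightarrow> real" where
  "penetration z = max 0 (fst z - fst (snd z))"

lemma penetration_lipschitz: "\<bar>penetration z - penetration w\<bar> \<le> 2 * norm (z - w)"
proof -
  obtain a b c d where e: "z - w = (a, b, c, d)" by (metis surj_pair)
  have "fst (z - w) = a" "fst (snd (z - w)) = b" unfolding e by simp_all
  then have "fst z - fst w = a" "fst (snd z) - fst (snd w) = b" by simp_all
  then have "\<bar>penetration z - penetration w\<bar> \<le> \<bar>a - b\<bar>"
    unfolding penetration_def max_def by (auto split: if_splits)
  then show ?thesis using abs_le_norm_state(1)[of a b c d] abs_le_norm_state(2)[of b a c d] unfolding e by linarith
qed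

text \<open>
  The relations on sum and product of the squared frequencies say that the generating system has
  the frequencies \<open>\<omega>\<close> and \<open>2 \<omega>\<close>. The stiffnesses are those of the generating system, \<open>k0t\<close> and \<open>k2t\<close>
  their first order perturbations.
\<close>

locale resonance_screen =
  fixes m1 m2 k0 k2 k0t k2t r \<omega> :: real
  assumes pos: "m1 > 0" "m2 > 0" "k0 > 0" "k2 > 0" "r > 0" "\<omega> > 0"
    and freq_sum: "(k0 + k2) / m2 + k0 / m1 = 5 * \<omega>\<^sup>2"
    and freq_prod: "k0 * k2 / (m1 * m2) = 4 * \<omega> ^ 4"
begin

text \<open>
  The terms of the vector field in the order of \<open>\<epsilon>\<close>: \<open>gen\<close> is the generating system, \<open>first_order\<close> the
  coefficient of \<open>\<epsilon>\<close>, with its linear part \<open>damp\<close> (damping and detuning), and \<open>second_order\<close> the whole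
  remainder divided by \<open>\<epsilon>\<^sup>2\<close>, which still depends on \<open>\<epsilon>\<close>. Both perturbations are written as a linear
  part, a multiple of the penetration and a term independent of the state, so that Lipschitz
  bounds can be read off. The parameter \<open>k\<close> is the stiffness coefficient of the stop.
\<close>

definition gen :: "state \<Rightarrow> state" where
  "gen = (\<lambda>(x1, x2, y1, y2). (y1 / m1, y2 / m2, - (k0 * (x1 - x2)), k0 * (x1 - x2) - k2 * x2))"

definition damp :: "state \<Rightarrow> state" where
  "damp = (\<lambda>(x1, x2, y1, y2).
     let F = - (k0 * (y1 / m1 - y2 / m2)) - k0t * (x1 - x2)
     in (0, 0, F, - F - k2 * (y2 / m2) - k2t * x2))"

definition first_order :: "real \<Rightarrow> real \<Rightarrow> state \<Rightarrow> state" where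
  "first_order k t z = damp z + penetration z *\<^sub>R (0, 0, - k, k) + (0, 0, r * cos (\<omega> * t), - (r * cos (\<omega> * t)))"

definition rest_lin :: "state \<Rightarrow> state" where
  "rest_lin = (\<lambda>(x1, x2, y1, y2).
     let F = - (k0t * (y1 / m1 - y2 / m2)) in (0, 0, F, - F - k2t * (y2 / m2)))"

definition rest_stop :: "real \<Rightarrow> real \<Rightarrow> state" where
  "rest_stop k \<epsilon> = (let F = (k0 + \<epsilon> * k0t) * \<epsilon> * k * (1 / m1 + 1 / m2)
     in (- (k / m1), k / m2, F, - F - (k2 + \<epsilon> * k2t) * \<epsilon> * k / m2))"

definition rest_force :: "real \<Rightarrow> real \<Rightarrow> state" where
  "rest_force \<epsilon> t = (let F = k0t * r * cos (\<omega> * t) / k0 - (k0 + \<epsilon> * k0t) * (r * \<omega> * sin (\<omega> * t) / k0)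
     in (0, 0, F, - F))"

definition second_order :: "real \<Rightarrow> real \<Rightarrow> real \<Rightarrow> state \<Rightarrow> state" where
  "second_order k \<epsilon> t z = rest_lin z + penetration z *\<^sub>R rest_stop k \<epsilon> + rest_force \<epsilon> t"

abbreviation field :: "real \<Rightarrow> real \<Rightarrow> real \<Rightarrow> state \<Rightarrow> state" where
  "field k \<equiv> screen_field m1 m2 k0 k2 k0t k2t (\<lambda>t. r * cos (\<omega> * t)) k"

lemma deriv_scaled_forcing: "deriv (\<lambda>t. \<epsilon> * (r * cos (\<omega> * t)) / k0) t = - (\<epsilon> * r * \<omega> * sin (\<omega> * t) / k0)"
  by (rule DERIV_imp_deriv) (use pos in \<open>auto intro!: derivative_eq_intros simp: field_simps\<close>)

lemma field_expansion:
  "field k \<epsilon> t z = gen z + \<epsilon> *\<^sub>R first_order k t z + \<epsilon>\<^sup>2 *\<^sub>R second_order k \<epsilon> t z"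
proof -
  obtain x1 x2 y1 y2 where z: "z = (x1, x2, y1, y2)" by (metis surj_pair)
  define p where "p = max 0 (x1 - x2)"
  define c where "c = cos (\<omega> * t)"
  define s where "s = sin (\<omega> * t)"
  show ?thesis
    unfolding z screen_field_def first_order_def second_order_def gen_def damp_def rest_lin_def
      rest_stop_def rest_force_def Let_def stop_force_def penetration_def deriv_scaled_forcing
    using pos
    by (simp flip: p_def c_def s_def) (simp add: field_simps power2_eq_square)
qed

lemma field_continuous: "continuous_on UNIV (\<lambda>(t, z). field k \<epsilon> t z)"
  unfolding screen_field_def stop_force_def Let_def deriv_scaled_forcing case_prod_beta
  using pos by (auto intro!: continuous_intros)

lemma bounded_linear_gen: "bounded_linear gen"
  unfolding linear_conv_bounded_linear[symmetric]
  by (rule linearI) (auto simp: gen_def algebra_simps add_divide_distrib)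

lemma bounded_linear_damp: "bounded_linear damp"
  unfolding linear_conv_bounded_linear[symmetric]
  by (rule linearI) (auto simp: damp_def algebra_simps add_divide_distrib)

lemma bounded_linear_rest_lin: "bounded_linear rest_lin"
  unfolding linear_conv_bounded_linear[symmetric]
  by (rule linearI) (auto simp: rest_lin_def algebra_simps add_divide_distrib)

lemma linear_plus_stop_lipschitz:
  assumes "bounded_linear M" "\<And>e. e \<in> E \<Longrightarrow> norm (v e) \<le> K" "K \<ge> 0"
  obtains L where "\<And>e z w. e \<in> E \<Longrightarrow>
    norm ((M z + penetration z *\<^sub>R v e) - (M w + penetration w *\<^sub>R v e)) \<le> L * norm (z - w)"
proof -
  interpret M: bounded_linear M by fact
  obtain KM where KM: "\<And>u. norm (M u) \<le> norm u * KM" using M.bounded by blast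
  have "norm ((M z + penetration z *\<^sub>R v e) - (M w + penetration w *\<^sub>R v e)) \<le> (KM + 2 * K) * norm (z - w)"
    if "e \<in> E" for e z w
  proof -
    have "(M z + penetration z *\<^sub>R v e) - (M w + penetration w *\<^sub>R v e)
        = M (z - w) + (penetration z - penetration w) *\<^sub>R v e"
      by (simp add: M.diff algebra_simps)
    also have "norm \<dots> \<le> norm (z - w) * KM + \<bar>penetration z - penetration w\<bar> * norm (v e)"
      by (rule order_trans[OF norm_triangle_ineq]) (use KM in auto)
    also have "\<bar>penetration z - penetration w\<bar> * norm (v e) \<le> (2 * norm (z - w)) * K"
      using penetration_lipschitz assms(2)[OF that] assms(3) by (intro mult_mono) auto
    finally show ?thesis by (simp add: algebra_simps)
  qed
  then show ?thesis using that by blast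
qed

lemma first_order_lipschitz:
  obtains L where "\<And>t z w. norm (first_order k t z - first_order k t w) \<le> L * norm (z - w)"
proof -
  obtain L where "\<And>e :: unit. \<And>z w. e \<in> UNIV \<Longrightarrow> norm ((damp z + penetration z *\<^sub>R (0, 0, - k, k))
      - (damp w + penetration w *\<^sub>R (0, 0, - k, k))) \<le> L * norm (z - w)"
    by (rule linear_plus_stop_lipschitz[OF bounded_linear_damp, of UNIV "\<lambda>_ :: unit. (0, 0, - k, k)"
          "norm (0::real, 0::real, - k, k)"]) auto
  then have "norm (first_order k t z - first_order k t w) \<le> L * norm (z - w)" for t z w
    unfolding first_order_def add_diff_cancel_right by simp
  then show ?thesis by (rule that)
qed

lemma bounded_on_unit_interval:
  fixes v :: "real \<Rightarrow> 'a::real_normed_vector"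
  assumes "continuous_on {0..1} v"
  obtains K where "K \<ge> 0" "\<And>\<epsilon>. \<epsilon> \<in> {0<..1} \<Longrightarrow> norm (v \<epsilon>) \<le> K"
proof -
  have "bounded (v ` {0..1})"
    by (intro compact_imp_bounded compact_continuous_image assms compact_Icc)
  then obtain K where "\<forall>x\<in>v ` {0..1}. norm x \<le> K" unfolding bounded_iff by blast
  then have "norm (v \<epsilon>) \<le> max 0 K" if "\<epsilon> \<in> {0<..1}" for \<epsilon>
    using that by (auto intro: max.coboundedI2)
  then show ?thesis using that[of "max 0 K"] by simp
qed

lemma second_order_lipschitz:
  obtains L where "\<And>\<epsilon> t z w. 0 < \<epsilon> \<Longrightarrow> \<epsilon> \<le> 1 \<Longrightarrow>
    norm (second_order k \<epsilon> t z - second_order k \<epsilon> t w) \<le> L * norm (z - w)"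
proof -
  have "continuous_on {0..1} (rest_stop k)"
    unfolding rest_stop_def Let_def by (intro continuous_intros) (use pos in auto)
  then obtain K where "K \<ge> 0" "\<And>\<epsilon>. \<epsilon> \<in> {0<..1} \<Longrightarrow> norm (rest_stop k \<epsilon>) \<le> K"
    using bounded_on_unit_interval by blast
  then obtain L where "\<And>\<epsilon> z w. \<epsilon> \<in> {0<..1} \<Longrightarrow>
    norm ((rest_lin z + penetration z *\<^sub>R rest_stop k \<epsilon>) - (rest_lin w + penetration w *\<^sub>R rest_stop k \<epsilon>)) \<le> L * norm (z - w)"
    using linear_plus_stop_lipschitz[OF bounded_linear_rest_lin, of "{0<..1}" "rest_stop k" K] by blast
  then show ?thesis using that[of L] by (simp add: second_order_def)
qed

lemma second_order_bound:
  obtains C where "\<And>\<epsilon> t. 0 < \<epsilon> \<Longrightarrow> \<epsilon> \<le> 1 \<Longrightarrow> norm (second_order k \<epsilon> t 0) \<le> C"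
proof -
  interpret R: bounded_linear rest_lin by (rule bounded_linear_rest_lin)
  define C where "C = \<bar>k0t\<bar> * r / k0 + (k0 + \<bar>k0t\<bar>) * (r * \<omega> / k0)"
  have "norm (second_order k \<epsilon> t 0) \<le> 2 * C" if \<epsilon>: "0 < \<epsilon>" "\<epsilon> \<le> 1" for \<epsilon> t
  proof -
    define F where "F = k0t * r * cos (\<omega> * t) / k0 - (k0 + \<epsilon> * k0t) * (r * \<omega> * sin (\<omega> * t) / k0)"
    have "\<bar>F\<bar> \<le> \<bar>k0t * r * cos (\<omega> * t) / k0\<bar> + \<bar>(k0 + \<epsilon> * k0t) * (r * \<omega> * sin (\<omega> * t) / k0)\<bar>"
      unfolding F_def by (rule abs_triangle_ineq4)
    also have "\<bar>k0t * r * cos (\<omega> * t) / k0\<bar> = \<bar>k0t\<bar> * r / k0 * \<bar>cos (\<omega> * t)\<bar>"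
      using pos by (simp add: abs_mult)
    also have "\<dots> \<le> \<bar>k0t\<bar> * r / k0 * 1" using pos by (intro mult_left_mono) auto
    also have "\<bar>(k0 + \<epsilon> * k0t) * (r * \<omega> * sin (\<omega> * t) / k0)\<bar>
        = \<bar>k0 + \<epsilon> * k0t\<bar> * (r * \<omega> / k0 * \<bar>sin (\<omega> * t)\<bar>)"
      using pos by (simp add: abs_mult)
    also have "\<dots> \<le> (k0 + \<bar>k0t\<bar>) * (r * \<omega> / k0 * 1)"
    proof (intro mult_mono mult_left_mono)
      have "\<bar>k0 + \<epsilon> * k0t\<bar> \<le> k0 + \<epsilon> * \<bar>k0t\<bar>"
        using abs_triangle_ineq[of k0 "\<epsilon> * k0t"] pos \<epsilon> by (simp add: abs_mult)
      also have "\<dots> \<le> k0 + 1 * \<bar>k0t\<bar>" using \<epsilon> by (intro add_left_mono mult_right_mono) auto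
      finally show "\<bar>k0 + \<epsilon> * k0t\<bar> \<le> k0 + \<bar>k0t\<bar>" by simp
    qed (use pos in auto)
    finally have F: "\<bar>F\<bar> \<le> C" by (simp add: C_def)
    have "second_order k \<epsilon> t 0 = (0, 0, F, - F)"
      by (simp add: second_order_def rest_force_def Let_def penetration_def R.zero F_def)
    also have "norm \<dots> \<le> norm (0::real) + (norm (0::real) + (norm F + norm (- F)))"
      by (intro order_trans[OF norm_Pair_le] add_left_mono order_refl)
    finally show ?thesis using F by simp
  qed
  then show ?thesis using that by blast
qed

text \<open>
  \<open>energy\<close> is the energy of the generating system. \<open>energy_correction\<close> adds the first order change of
  the stiffnesses and the mixed term \<open>2 \<kappa> (x1 y1 + x2 y2)\<close>, which makes the decay strict in the
  positions.
\<close>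

definition energy :: "state \<Rightarrow> state \<Rightarrow> real" where
  "energy = (\<lambda>(a1, a2, b1, b2) (c1, c2, d1, d2).
     b1 * d1 / m1 + b2 * d2 / m2 + k0 * ((a1 - a2) * (c1 - c2)) + k2 * (a2 * c2))"

definition energy_correction :: "real \<Rightarrow> state \<Rightarrow> state \<Rightarrow> real" where
  "energy_correction \<kappa> = (\<lambda>(a1, a2, b1, b2) (c1, c2, d1, d2).
     k0t * ((a1 - a2) * (c1 - c2)) + k2t * (a2 * c2) + \<kappa> * (a1 * d1 + b1 * c1 + a2 * d2 + b2 * c2))"

lemma bounded_bilinear_energy: "bounded_bilinear energy"
  unfolding bilinear_conv_bounded_bilinear[symmetric] bilinear_def
  by (intro conjI allI linearI) (auto simp: energy_def algebra_simps add_divide_distrib)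

lemma bounded_bilinear_energy_correction: "bounded_bilinear (energy_correction \<kappa>)"
  unfolding bilinear_conv_bounded_bilinear[symmetric] bilinear_def
  by (intro conjI allI linearI) (auto simp: energy_correction_def algebra_simps)

lemma energy_sym: "energy u v = energy v u"
  by (cases u, cases v) (auto simp: energy_def algebra_simps)

lemma energy_correction_sym: "energy_correction \<kappa> u v = energy_correction \<kappa> v u"
  by (cases u, cases v) (auto simp: energy_correction_def algebra_simps)

lemma energy_conserved: "energy u (gen u) = 0"
  using pos by (cases u) (auto simp: energy_def gen_def field_simps)

lemma energy_coercive:
  obtains h where "h > 0" "\<And>u. h * (norm u)\<^sup>2 \<le> energy u u"
proof -
  define h where "h = min (min (1 / m1) (1 / m2)) (min k0 k2)"
  have h: "h > 0" "h \<le> 1 / m1" "h \<le> 1 / m2" "h \<le> k0" "h \<le> k2" using pos by (auto simp: h_def)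
  have "h / 3 * (norm u)\<^sup>2 \<le> energy u u" for u
  proof -
    obtain a b c d where u: "u = (a, b, c, d)" by (metis surj_pair)
    have "a\<^sup>2 \<le> 2 * (a - b)\<^sup>2 + 2 * b\<^sup>2"
      using zero_le_power2[of "a - 2 * b"] by (simp add: power2_eq_square algebra_simps)
    moreover have "x + y + z + w \<le> 3 * (e + y + z + w)" if "x \<le> 2 * e + 2 * y" "e \<ge> 0" "z \<ge> 0" "w \<ge> 0"
      for x y z w e :: real using that by (simp add: distrib_left)
    ultimately have "a\<^sup>2 + b\<^sup>2 + c\<^sup>2 + d\<^sup>2 \<le> 3 * ((a - b)\<^sup>2 + b\<^sup>2 + c\<^sup>2 + d\<^sup>2)"
      by (metis zero_le_power2)
    then have "h / 3 * (norm u)\<^sup>2 \<le> h / 3 * (3 * ((a - b)\<^sup>2 + b\<^sup>2 + c\<^sup>2 + d\<^sup>2))"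
      unfolding u norm_state using h(1) by (intro mult_left_mono) auto
    also have "\<dots> = h * (a - b)\<^sup>2 + h * b\<^sup>2 + h * c\<^sup>2 + h * d\<^sup>2" by (simp add: algebra_simps)
    also have "\<dots> \<le> k0 * (a - b)\<^sup>2 + k2 * b\<^sup>2 + 1 / m1 * c\<^sup>2 + 1 / m2 * d\<^sup>2"
      using h by (intro add_mono mult_right_mono) auto
    also have "\<dots> = energy u u" by (simp add: u energy_def power2_eq_square)
    finally show ?thesis .
  qed
  then show ?thesis using that[of "h / 3"] h(1) by simp
qed

text \<open>
  The damping is proportional to the stiffness matrix and therefore complete; a stop that is soft
  compared with it cannot destroy the dissipation.
\<close>

lemma first_order_dissipative:
  obtains \<delta> \<kappa> c where "\<delta> > 0" "c > 0"
    "\<And>k t z w. 0 < k \<Longrightarrow> k \<le> \<delta> \<Longrightarrow> energy (z - w) (first_order k t z - first_order k t w)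
       + energy_correction \<kappa> (z - w) (gen (z - w)) \<le> - c * (norm (z - w))\<^sup>2"
proof -
  \<comment> \<open>the kinetic part of the mixed term may use up half of the damping\<close>
  define \<kappa> where "\<kappa> = min (k0 / (4 * m1)) (k2 / (2 * (2 * m1 + m2)))"
  have \<kappa>: "\<kappa> > 0" "2 * m1 * \<kappa> \<le> k0 / 2" "(2 * m1 + m2) * \<kappa> \<le> k2 / 2"
  proof -
    show "\<kappa> > 0" using pos by (simp add: \<kappa>_def)
    have "\<kappa> \<le> k0 / (4 * m1)" "\<kappa> \<le> k2 / (2 * (2 * m1 + m2))" by (simp_all add: \<kappa>_def)
    then show "2 * m1 * \<kappa> \<le> k0 / 2" "(2 * m1 + m2) * \<kappa> \<le> k2 / 2"
      using pos by (simp_all add: field_simps)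
  qed
  define \<delta> where "\<delta> = min (k0 / 2) (\<kappa> * k0)"
  have \<delta>: "\<delta> > 0" "\<delta> \<le> k0 / 2" "\<delta> \<le> \<kappa> * k0" using pos \<kappa>(1) by (auto simp: \<delta>_def)
  define e where "e = min (min (k0 / 4) (k2 / 2)) (min (\<kappa> * k0 / 2) (\<kappa> * k2))"
  have e: "e > 0" "e \<le> k0 / 4" "e \<le> k2 / 2" "e \<le> \<kappa> * k0 / 2" "e \<le> \<kappa> * k2"
    using pos \<kappa>(1) by (auto simp: e_def)
  define M where "M = 3 + 2 * m1\<^sup>2 + m2\<^sup>2"
  have M: "M > 0" unfolding M_def by (simp add: add_pos_nonneg)
  have "energy (z - w) (first_order k t z - first_order k t w)
       + energy_correction \<kappa> (z - w) (gen (z - w)) \<le> - (e / M) * (norm (z - w))\<^sup>2"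
    if k: "0 < k" "k \<le> \<delta>" for k t z w
  proof -
    interpret D: bounded_linear damp by (rule bounded_linear_damp)
    obtain a1 a2 b1 b2 where u: "z - w = (a1, a2, b1, b2)" by (metis surj_pair)
    define p where "p = penetration z - penetration w"
    define d v1 v2 where "d = a1 - a2" and "v1 = b1 / m1" and "v2 = b2 / m2"
    define W where "W = v1 - v2"
    have "fst (z - w) = a1" "fst (snd (z - w)) = a2" unfolding u by simp_all
    then have "fst z - fst w = a1" "fst (snd z) - fst (snd w) = a2" by simp_all
    then have p: "\<bar>p\<bar> \<le> \<bar>d\<bar>"
      unfolding p_def d_def penetration_def max_def by (auto split: if_splits)
    have diff: "first_order k t z - first_order k t w = damp (z - w) + p *\<^sub>R (0, 0, - k, k)"
      by (simp add: first_order_def p_def D.diff algebra_simps)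
    have b: "b1 = m1 * v1" "b2 = m2 * v2" using pos by (simp_all add: v1_def v2_def)
    have "energy (z - w) (first_order k t z - first_order k t w) + energy_correction \<kappa> (z - w) (gen (z - w))
        = - k0 * W\<^sup>2 - k2 * v2\<^sup>2 - k * (p * W) + \<kappa> * (m1 * v1\<^sup>2 + m2 * v2\<^sup>2 - k0 * d\<^sup>2 - k2 * a2\<^sup>2)"
      unfolding diff u energy_def energy_correction_def damp_def gen_def Let_def b W_def d_def
      using pos by (simp add: power2_eq_square algebra_simps)
    also have "\<dots> \<le> - e * (W\<^sup>2 + v2\<^sup>2 + d\<^sup>2 + a2\<^sup>2)"
    proof -
      have "v1\<^sup>2 \<le> 2 * W\<^sup>2 + 2 * v2\<^sup>2"
        using zero_le_power2[of "v1 - 2 * v2"] by (simp add: W_def power2_eq_square algebra_simps)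
      then have "\<kappa> * (m1 * v1\<^sup>2) \<le> \<kappa> * (m1 * (2 * W\<^sup>2 + 2 * v2\<^sup>2))"
        using \<kappa>(1) pos by (intro mult_left_mono) auto
      then have "\<kappa> * (m1 * v1\<^sup>2 + m2 * v2\<^sup>2) \<le> (2 * m1 * \<kappa>) * W\<^sup>2 + ((2 * m1 + m2) * \<kappa>) * v2\<^sup>2"
        by (simp add: algebra_simps)
      also have "\<dots> \<le> k0 / 2 * W\<^sup>2 + k2 / 2 * v2\<^sup>2"
        using \<kappa> by (intro add_mono mult_right_mono) auto
      finally have 1: "\<kappa> * (m1 * v1\<^sup>2 + m2 * v2\<^sup>2) \<le> k0 / 2 * W\<^sup>2 + k2 / 2 * v2\<^sup>2" .
      have "- (p * W) \<le> \<bar>p\<bar> * \<bar>W\<bar>" by (metis abs_ge_minus_self abs_mult)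
      also have "\<dots> \<le> \<bar>d\<bar> * \<bar>W\<bar>" using p by (intro mult_right_mono) auto
      also have "\<dots> \<le> (d\<^sup>2 + W\<^sup>2) / 2"
        using zero_le_power2[of "\<bar>d\<bar> - \<bar>W\<bar>"] by (simp add: power2_diff)
      finally have "k * (- (p * W)) \<le> k * ((d\<^sup>2 + W\<^sup>2) / 2)"
        using k by (intro mult_left_mono) auto
      moreover have "k * d\<^sup>2 \<le> \<kappa> * k0 * d\<^sup>2" "k * W\<^sup>2 \<le> k0 / 2 * W\<^sup>2"
        by (intro mult_right_mono; use k \<delta> in simp)+
      moreover have "e * W\<^sup>2 \<le> k0 / 4 * W\<^sup>2" "e * v2\<^sup>2 \<le> k2 / 2 * v2\<^sup>2"
        "e * d\<^sup>2 \<le> \<kappa> * k0 / 2 * d\<^sup>2" "e * a2\<^sup>2 \<le> \<kappa> * k2 * a2\<^sup>2"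
        by (intro mult_right_mono; use e in simp)+
      ultimately show ?thesis using 1 by (simp add: algebra_simps)
    qed
    also have "\<dots> \<le> - (e / M) * (norm (z - w))\<^sup>2"
    proof -
      have "a1\<^sup>2 \<le> 2 * d\<^sup>2 + 2 * a2\<^sup>2"
        using zero_le_power2[of "a1 - 2 * a2"] by (simp add: d_def power2_eq_square algebra_simps)
      moreover have "v1\<^sup>2 \<le> 2 * W\<^sup>2 + 2 * v2\<^sup>2"
        using zero_le_power2[of "v1 - 2 * v2"] by (simp add: W_def power2_eq_square algebra_simps)
      then have "m1\<^sup>2 * v1\<^sup>2 \<le> m1\<^sup>2 * (2 * W\<^sup>2 + 2 * v2\<^sup>2)" by (intro mult_left_mono) auto
      then have "m1\<^sup>2 * v1\<^sup>2 \<le> 2 * (m1\<^sup>2 * W\<^sup>2) + 2 * (m1\<^sup>2 * v2\<^sup>2)" by (simp add: algebra_simps)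
      moreover have "0 \<le> m1\<^sup>2 * d\<^sup>2" "0 \<le> m1\<^sup>2 * a2\<^sup>2" "0 \<le> m2\<^sup>2 * d\<^sup>2" "0 \<le> m2\<^sup>2 * a2\<^sup>2" "0 \<le> m2\<^sup>2 * W\<^sup>2"
        "0 \<le> d\<^sup>2" "0 \<le> W\<^sup>2" "0 \<le> v2\<^sup>2" by simp_all
      moreover have "M * (W\<^sup>2 + v2\<^sup>2 + d\<^sup>2 + a2\<^sup>2) = 3 * W\<^sup>2 + 3 * v2\<^sup>2 + 3 * d\<^sup>2 + 3 * a2\<^sup>2
          + 2 * (m1\<^sup>2 * W\<^sup>2) + 2 * (m1\<^sup>2 * v2\<^sup>2) + 2 * (m1\<^sup>2 * d\<^sup>2) + 2 * (m1\<^sup>2 * a2\<^sup>2)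
          + m2\<^sup>2 * W\<^sup>2 + m2\<^sup>2 * v2\<^sup>2 + m2\<^sup>2 * d\<^sup>2 + m2\<^sup>2 * a2\<^sup>2"
        by (simp add: M_def algebra_simps)
      ultimately have "(norm (z - w))\<^sup>2 \<le> M * (W\<^sup>2 + v2\<^sup>2 + d\<^sup>2 + a2\<^sup>2)"
        unfolding u norm_state b power_mult_distrib by linarith
      then have "e / M * (norm (z - w))\<^sup>2 \<le> e / M * (M * (W\<^sup>2 + v2\<^sup>2 + d\<^sup>2 + a2\<^sup>2))"
        using e(1) M by (intro mult_left_mono) auto
      then show ?thesis using M by simp
    qed
    finally show ?thesis .
  qed
  then show ?thesis using that[of \<delta> "e / M" \<kappa>] \<delta>(1) e(1) M by simp
qed

end

context resonance_screen
begin

section \<open>Modes and averaged equations\<close>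

definition T :: real where "T = 2 * pi / \<omega>"

text \<open>The second components of the two normal modes; the first component of both is \<open>- k0\<close>.\<close>

definition \<phi>1 :: real where "\<phi>1 = m1 * \<omega>\<^sup>2 - k0"
definition \<phi>2 :: real where "\<phi>2 = 4 * m1 * \<omega>\<^sup>2 - k0"

text \<open>
  A force \<open>(F, G - F)\<close> on the two masses drives the modal coordinates by \<open>\<psi>1 F - \<sigma> G\<close> and
  \<open>\<psi>2 F + \<sigma> G\<close>.
\<close>

definition \<sigma> :: real where "\<sigma> = 1 / (3 * m1 * m2 * \<omega>\<^sup>2)"
definition \<psi>1 :: real where "\<psi>1 = - \<sigma> * (m2 * \<phi>2 / (m1 * k0) - 1)"
definition \<psi>2 :: real where "\<psi>2 = \<sigma> * (m2 * \<phi>1 / (m1 * k0) - 1)"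

text \<open>The coefficients of the averaged equations.\<close>

definition \<alpha> :: real where "\<alpha> = coef_alpha m1 m2 k0 k2 \<omega>"
definition \<beta> :: real where "\<beta> = coef_beta m1 m2 k0 k0t k2t \<omega>"
definition \<gamma> :: real where "\<gamma> = coef_gamma m1 m2 k0 k2 \<omega>"
definition \<mu> :: real where "\<mu> = coef_mu m1 m2 k0 r \<omega>"

text \<open>The detuning of the second mode, the analogue of \<open>\<beta>\<close>.\<close>

definition \<beta>2 :: real where "\<beta>2 = - (4 * \<psi>2 * k0t * m1 * \<omega>\<^sup>2 - \<sigma> * k2t * \<phi>2) / (4 * \<omega>)"

lemma T_pos: "T > 0" and \<omega>T: "\<omega> * T = 2 * pi"
  using pos by (auto simp: T_def)

lemma freq_sum': "m1 * (k0 + k2) + m2 * k0 = 5 * \<omega>\<^sup>2 * m1 * m2"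
  using freq_sum pos by (simp add: field_simps)

lemma freq_prod': "k0 * k2 = 4 * \<omega> ^ 4 * m1 * m2"
  using freq_prod pos by (simp add: field_simps)

lemma mode1: "k0 * m1 * \<omega>\<^sup>2 + k2 * \<phi>1 = \<omega>\<^sup>2 * m2 * \<phi>1"
  unfolding \<phi>1_def using freq_sum' freq_prod' by algebra

lemma mode2: "4 * k0 * m1 * \<omega>\<^sup>2 + k2 * \<phi>2 = 4 * \<omega>\<^sup>2 * m2 * \<phi>2"
  unfolding \<phi>2_def using freq_sum' freq_prod' by algebra

lemma modes_orthogonal: "m2 * (\<phi>1 * \<phi>2) = - m1 * k0\<^sup>2"
  unfolding \<phi>1_def \<phi>2_def using freq_sum' freq_prod' by algebra

lemma \<phi>_diff: "\<phi>2 - \<phi>1 = 3 * m1 * \<omega>\<^sup>2"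
  by (simp add: \<phi>1_def \<phi>2_def)

lemma \<phi>_sign: "\<phi>1 < 0" "\<phi>2 > 0"
proof -
  have "m2 * (\<phi>1 * \<phi>2) < 0" unfolding modes_orthogonal using pos by simp
  then have "\<phi>1 * \<phi>2 < 0" using pos by (simp add: mult_less_0_iff)
  moreover have "\<phi>1 < \<phi>2" using \<phi>_diff pos by (smt (verit) mult_pos_pos zero_less_power)
  ultimately show "\<phi>1 < 0" "\<phi>2 > 0" by (auto simp: mult_less_0_iff)
qed

lemma \<sigma>_pos: "\<sigma> > 0" using pos by (simp add: \<sigma>_def)

lemma \<psi>2_neg: "\<psi>2 < 0"
proof -
  have "m2 * \<phi>1 / (m1 * k0) < 0" using \<phi>_sign pos by (simp add: divide_neg_pos mult_pos_neg)
  then show ?thesis using \<sigma>_pos by (simp add: \<psi>2_def mult_pos_neg)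
qed

lemma \<sigma>_mult: "\<sigma> * (3 * m1 * m2 * \<omega>\<^sup>2) = 1"
  using pos by (simp add: \<sigma>_def)

lemma \<psi>_k0: "\<psi>1 * (m1 * k0) = - \<sigma> * (m2 * \<phi>2 - m1 * k0)" "\<psi>2 * (m1 * k0) = \<sigma> * (m2 * \<phi>1 - m1 * k0)"
  using pos by (simp_all add: \<psi>1_def \<psi>2_def field_simps)

lemma \<alpha>_eq: "\<alpha> = \<omega>\<^sup>2 / 2"
proof -
  have "\<alpha> = \<omega> / 6 * (k0 * k2 / (m1 * m2) / \<omega> ^ 3 - (k0 / m1 + (k0 + k2) / m2) / \<omega> + 4 * \<omega>)"
    unfolding \<alpha>_def coef_alpha_def using pos by (simp add: field_simps)
  also have "k0 / m1 + (k0 + k2) / m2 = 5 * \<omega>\<^sup>2" using freq_sum by simp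
  finally show ?thesis
    unfolding freq_prod using pos by (simp add: power2_eq_square power3_eq_cube power4_eq_xxxx)
qed

lemma \<gamma>_eq: "\<gamma> = 2 * \<omega>\<^sup>2"
proof -
  have "\<gamma> = \<omega> / 6 * (4 * (k0 / m1 + (k0 + k2) / m2) / \<omega> - k0 * k2 / (m1 * m2) / \<omega> ^ 3 - 4 * \<omega>)"
    unfolding \<gamma>_def coef_gamma_def using pos by (simp add: field_simps)
  also have "k0 / m1 + (k0 + k2) / m2 = 5 * \<omega>\<^sup>2" using freq_sum by simp
  finally show ?thesis
    unfolding freq_prod using pos by (simp add: power2_eq_square power3_eq_cube power4_eq_xxxx)
qed

lemma \<psi>1_eq: "\<psi>1 = - (4 * \<omega>\<^sup>2 / k0 - 1 / m1 - 1 / m2) / (3 * m1 * \<omega>\<^sup>2)"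
  unfolding \<psi>1_def \<sigma>_def \<phi>2_def using pos by (simp add: field_simps)

lemma mode1_forcing: "\<psi>1 * r = 2 * \<omega> * \<mu>"
  unfolding \<psi>1_eq \<mu>_def coef_mu_def using pos
  by (simp add: field_simps power2_eq_square power3_eq_cube)

lemma mode1_detuning: "\<psi>1 * k0t * m1 * \<omega>\<^sup>2 + \<sigma> * k2t * \<phi>1 = - 2 * \<omega> * \<beta>"
proof -
  have "\<sigma> * k2t * \<phi>1 = k2t / 3 * (1 / m2 - k0 / (m1 * m2 * \<omega>\<^sup>2))"
    unfolding \<sigma>_def \<phi>1_def using pos by (simp add: field_simps)
  moreover have "\<psi>1 * k0t * m1 * \<omega>\<^sup>2 = - k0t / 3 * (4 * \<omega>\<^sup>2 / k0 - 1 / m1 - 1 / m2)"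
    unfolding \<psi>1_eq using pos by (simp add: field_simps)
  moreover have "- 2 * \<omega> * \<beta> = - k0t / 3 * (4 * \<omega>\<^sup>2 / k0 - 1 / m1 - 1 / m2)
      + k2t / 3 * (1 / m2 - k0 / (m1 * m2 * \<omega>\<^sup>2))"
    unfolding \<beta>_def coef_beta_def using pos
    by (simp add: field_simps power2_eq_square power4_eq_xxxx)
  ultimately show ?thesis by simp
qed

lemma mode1_damping: "\<psi>1 * k0 * m1 * \<omega>\<^sup>2 + \<sigma> * k2 * \<phi>1 = - \<omega>\<^sup>2"
  using \<psi>_k0(1) \<sigma>_mult mode1 \<phi>_diff by algebra

lemma mode2_damping: "4 * \<psi>2 * k0 * m1 * \<omega>\<^sup>2 - \<sigma> * k2 * \<phi>2 = - 4 * \<omega>\<^sup>2"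
  using \<psi>_k0(2) \<sigma>_mult mode2 \<phi>_diff by algebra

lemma mode2_detuning: "4 * \<psi>2 * k0t * m1 * \<omega>\<^sup>2 - \<sigma> * k2t * \<phi>2 = - 4 * \<omega> * \<beta>2"
  using pos by (simp add: \<beta>2_def)

text \<open>The forcing always acts on the first mode, because \<open>k0 (m1 + m2) < 4 m1 m2 \<omega>\<^sup>2\<close>.\<close>

lemma \<mu>_nonzero: "\<mu> \<noteq> 0"
proof -
  have "\<phi>1 + k0 > 0" using pos by (simp add: \<phi>1_def)
  then have "\<phi>1 * (m2 * \<phi>2) > - k0 * (m2 * \<phi>2)"
    using pos \<phi>_sign by (intro mult_strict_right_mono) auto
  then have "k0 * (m2 * \<phi>2 - m1 * k0) > 0"
    using modes_orthogonal by (simp add: algebra_simps power2_eq_square)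
  then have "m2 * \<phi>2 - m1 * k0 > 0" using pos by (simp add: zero_less_mult_iff)
  then have "\<psi>1 * (m1 * k0) < 0" unfolding \<psi>_k0 using \<sigma>_pos by simp
  then show ?thesis using mode1_forcing pos by auto
qed

text \<open>
  An amplitude vector \<open>(C1, S1, C2, S2)\<close> determines a free motion; \<open>defl\<close> is its relative
  displacement \<open>x1 - x2\<close>.
\<close>

definition free_motion :: "state \<Rightarrow> real \<Rightarrow> state" where
  "free_motion = (\<lambda>(C1, S1, C2, S2) t.
     (limit1 k0 \<omega> C1 S1 C2 S2 t, limit2 m1 k0 \<omega> C1 S1 C2 S2 t,
      - (m1 * k0 * \<omega>) * (C1 * cos (\<omega> * t) - S1 * sin (\<omega> * t))
      - 2 * (m1 * k0 * \<omega>) * (C2 * cos (2 * \<omega> * t) - S2 * sin (2 * \<omega> * t)),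
      m2 * \<phi>1 * \<omega> * (C1 * cos (\<omega> * t) - S1 * sin (\<omega> * t))
      + 2 * (m2 * \<phi>2 * \<omega>) * (C2 * cos (2 * \<omega> * t) - S2 * sin (2 * \<omega> * t))))"

definition defl :: "state \<Rightarrow> real \<Rightarrow> real" where
  "defl = (\<lambda>(C1, S1, C2, S2) t. - (m1 * \<omega>\<^sup>2) * (C1 * sin (\<omega> * t) + S1 * cos (\<omega> * t)
     + 4 * (C2 * sin (2 * \<omega> * t) + S2 * cos (2 * \<omega> * t))))"

text \<open>The integral of the penetration along a free motion against \<open>e\<close> over one period.\<close>

definition stop_harmonic :: "(real \<Rightarrow> real) \<Rightarrow> state \<Rightarrow> real" where
  "stop_harmonic e a = integral {0..T} (\<lambda>t. max 0 (defl a t) * e t)"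

lemma trig_periodic:
  "sin (\<omega> * (t + T)) = sin (\<omega> * t)" "cos (\<omega> * (t + T)) = cos (\<omega> * t)"
  "sin (2 * \<omega> * (t + T)) = sin (2 * \<omega> * t)" "cos (2 * \<omega> * (t + T)) = cos (2 * \<omega> * t)"
proof -
  have e: "\<omega> * (t + T) = \<omega> * t + 2 * pi" "2 * \<omega> * (t + T) = 2 * \<omega> * t + 2 * pi + 2 * pi"
    using \<omega>T by (simp_all add: distrib_left mult.assoc)
  show "sin (\<omega> * (t + T)) = sin (\<omega> * t)" "cos (\<omega> * (t + T)) = cos (\<omega> * t)"
    "sin (2 * \<omega> * (t + T)) = sin (2 * \<omega> * t)" "cos (2 * \<omega> * (t + T)) = cos (2 * \<omega> * t)"
    unfolding e by (simp_all only: sin_periodic cos_periodic)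
qed

lemma free_motion_solves: "(free_motion a has_vector_derivative gen (free_motion a t)) (at t)"
proof -
  obtain C1 S1 C2 S2 where a: "a = (C1, S1, C2, S2)" by (metis surj_pair)
  define s1 c1 s2 c2 where "s1 = sin (\<omega> * t)" and "c1 = cos (\<omega> * t)"
    and "s2 = sin (2 * \<omega> * t)" and "c2 = cos (2 * \<omega> * t)"
  note trig = s1_def c1_def s2_def c2_def
  define U where "U = C1 * s1 + S1 * c1"
  define V where "V = C2 * s2 + S2 * c2"
  have x1: "(limit1 k0 \<omega> C1 S1 C2 S2 has_real_derivative
      (- k0 * \<omega> * (C1 * c1 - S1 * s1) - 2 * k0 * \<omega> * (C2 * c2 - S2 * s2))) (at t)"
    unfolding limit1_def trig by (auto intro!: derivative_eq_intros simp: algebra_simps)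
  have x2: "(limit2 m1 k0 \<omega> C1 S1 C2 S2 has_real_derivative
      (\<phi>1 * \<omega> * (C1 * c1 - S1 * s1) + 2 * \<phi>2 * \<omega> * (C2 * c2 - S2 * s2))) (at t)"
    unfolding limit2_def trig \<phi>1_def \<phi>2_def by (auto intro!: derivative_eq_intros simp: algebra_simps)
  have y1: "((\<lambda>t. - (m1 * k0 * \<omega>) * (C1 * cos (\<omega> * t) - S1 * sin (\<omega> * t))
      - 2 * (m1 * k0 * \<omega>) * (C2 * cos (2 * \<omega> * t) - S2 * sin (2 * \<omega> * t))) has_real_derivative
      (k0 * m1 * \<omega>\<^sup>2 * (U + 4 * V))) (at t)"
    unfolding trig U_def V_def
    by (auto intro!: derivative_eq_intros simp: algebra_simps power2_eq_square)
  have y2: "((\<lambda>t. m2 * \<phi>1 * \<omega> * (C1 * cos (\<omega> * t) - S1 * sin (\<omega> * t))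
      + 2 * (m2 * \<phi>2 * \<omega>) * (C2 * cos (2 * \<omega> * t) - S2 * sin (2 * \<omega> * t))) has_real_derivative
      (- (\<omega>\<^sup>2 * m2 * \<phi>1) * U - (4 * \<omega>\<^sup>2 * m2 * \<phi>2) * V)) (at t)"
    unfolding trig U_def V_def
    by (auto intro!: derivative_eq_intros simp: algebra_simps power2_eq_square)
  have l1: "limit1 k0 \<omega> C1 S1 C2 S2 t = - k0 * U - k0 * V"
    unfolding limit1_def trig U_def V_def by (simp add: algebra_simps)
  have l2: "limit2 m1 k0 \<omega> C1 S1 C2 S2 t = \<phi>1 * U + \<phi>2 * V"
    unfolding limit2_def trig U_def V_def \<phi>1_def \<phi>2_def by simp
  have diff: "limit1 k0 \<omega> C1 S1 C2 S2 t - limit2 m1 k0 \<omega> C1 S1 C2 S2 t = - (m1 * \<omega>\<^sup>2) * (U + 4 * V)"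
    unfolding l1 l2 \<phi>1_def \<phi>2_def by (simp add: algebra_simps)
  have "k0 * (limit1 k0 \<omega> C1 S1 C2 S2 t - limit2 m1 k0 \<omega> C1 S1 C2 S2 t) - k2 * limit2 m1 k0 \<omega> C1 S1 C2 S2 t
      = - (k0 * m1 * \<omega>\<^sup>2 + k2 * \<phi>1) * U - (4 * k0 * m1 * \<omega>\<^sup>2 + k2 * \<phi>2) * V"
    unfolding diff unfolding l2 by (simp add: algebra_simps)
  then have y2': "k0 * (limit1 k0 \<omega> C1 S1 C2 S2 t - limit2 m1 k0 \<omega> C1 S1 C2 S2 t) - k2 * limit2 m1 k0 \<omega> C1 S1 C2 S2 t
      = - (\<omega>\<^sup>2 * m2 * \<phi>1) * U - (4 * \<omega>\<^sup>2 * m2 * \<phi>2) * V"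
    unfolding mode1 mode2 .
  have "gen (free_motion a t) =
    (- k0 * \<omega> * (C1 * c1 - S1 * s1) - 2 * k0 * \<omega> * (C2 * c2 - S2 * s2),
     \<phi>1 * \<omega> * (C1 * c1 - S1 * s1) + 2 * \<phi>2 * \<omega> * (C2 * c2 - S2 * s2),
     k0 * m1 * \<omega>\<^sup>2 * (U + 4 * V), - (\<omega>\<^sup>2 * m2 * \<phi>1) * U - (4 * \<omega>\<^sup>2 * m2 * \<phi>2) * V)"
    unfolding a free_motion_def gen_def prod.case y2' using pos
    by (simp add: diff flip: trig) (simp add: field_simps)
  then show ?thesis
    unfolding a free_motion_def prod.case
    using x1 x2 y1 y2 by (auto simp: has_real_derivative_iff_has_vector_derivative intro!: has_vector_derivative_Pair)
qed

lemma free_motion_periodic: "free_motion a (t + T) = free_motion a t"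
  by (cases a) (simp add: free_motion_def limit1_def limit2_def trig_periodic)

lemma penetration_free_motion: "penetration (free_motion a t) = max 0 (defl a t)"
proof -
  obtain C1 S1 C2 S2 where a: "a = (C1, S1, C2, S2)" by (metis surj_pair)
  have "limit1 k0 \<omega> C1 S1 C2 S2 t - limit2 m1 k0 \<omega> C1 S1 C2 S2 t = defl a t"
    by (simp add: a defl_def limit1_def limit2_def algebra_simps)
  then show ?thesis by (simp add: penetration_def free_motion_def a)
qed

lemma defl_periodic: "defl a (t + T) = defl a t"
  by (cases a) (simp add: defl_def trig_periodic)

lemma defl_continuous: "continuous_on S (defl a)"
  by (cases a) (auto simp: defl_def intro!: continuous_intros)

lemma stop_harmonic_has_integral:
  assumes "continuous_on UNIV e"
  shows "((\<lambda>t. max 0 (defl a t) * e t) has_integral stop_harmonic e a) {0..T}"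
  unfolding stop_harmonic_def
  by (intro integrable_integral integrable_continuous_interval continuous_intros defl_continuous
      continuous_on_subset[OF assms]) auto

lemma stop_harmonic_lipschitz:
  assumes e: "continuous_on UNIV e" "\<And>t. \<bar>e t\<bar> \<le> 1"
  shows "(10 * m1 * \<omega>\<^sup>2 * T)-lipschitz_on UNIV (stop_harmonic e)"
proof (rule lipschitz_onI)
  fix a b :: state
  define K where "K = 10 * m1 * \<omega>\<^sup>2 * norm (a - b)"
  have bound: "\<bar>max 0 (defl a t) * e t - max 0 (defl b t) * e t\<bar> \<le> K" for t
  proof -
    obtain C1 S1 C2 S2 where ab: "a - b = (C1, S1, C2, S2)" by (metis surj_pair)
    have "defl a t - defl b t = defl (a - b) t"
      by (cases a, cases b) (simp add: defl_def algebra_simps)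
    also have "\<bar>\<dots>\<bar> = m1 * \<omega>\<^sup>2 * \<bar>C1 * sin (\<omega> * t) + S1 * cos (\<omega> * t)
        + 4 * (C2 * sin (2 * \<omega> * t) + S2 * cos (2 * \<omega> * t))\<bar>"
      using pos by (simp add: ab defl_def abs_mult)
    also have "\<dots> \<le> m1 * \<omega>\<^sup>2 * (10 * norm (a - b))"
    proof (intro mult_left_mono)
      have *: "\<bar>x * y\<bar> \<le> norm (a - b)" if "\<bar>x\<bar> \<le> norm (a - b)" "\<bar>y\<bar> \<le> 1" for x y :: real
        using mult_mono[OF that] by (simp add: abs_mult)
      have "\<bar>C1 * sin (\<omega> * t)\<bar> \<le> norm (a - b)" "\<bar>S1 * cos (\<omega> * t)\<bar> \<le> norm (a - b)"
        "\<bar>C2 * sin (2 * \<omega> * t)\<bar> \<le> norm (a - b)" "\<bar>S2 * cos (2 * \<omega> * t)\<bar> \<le> norm (a - b)"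
        by (intro *; simp add: ab abs_le_norm_state)+
      then show "\<bar>C1 * sin (\<omega> * t) + S1 * cos (\<omega> * t)
          + 4 * (C2 * sin (2 * \<omega> * t) + S2 * cos (2 * \<omega> * t))\<bar> \<le> 10 * norm (a - b)"
        unfolding distrib_left by linarith
    qed (use pos in auto)
    finally have d: "\<bar>defl a t - defl b t\<bar> \<le> K" by (simp add: K_def mult_ac)
    have "\<bar>max 0 (defl a t) * e t - max 0 (defl b t) * e t\<bar>
        = \<bar>max 0 (defl a t) - max 0 (defl b t)\<bar> * \<bar>e t\<bar>"
      by (simp flip: abs_mult add: algebra_simps)
    also have "\<dots> \<le> \<bar>max 0 (defl a t) - max 0 (defl b t)\<bar> * 1"
      by (intro mult_left_mono e(2)) auto
    also have "\<dots> \<le> \<bar>defl a t - defl b t\<bar>" by (auto simp: max_def)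
    finally show ?thesis using d by linarith
  qed
  have "((\<lambda>t. max 0 (defl a t) * e t - max 0 (defl b t) * e t) has_integral
      (stop_harmonic e a - stop_harmonic e b)) {0..T}"
    by (intro has_integral_diff stop_harmonic_has_integral e(1))
  from has_integral_bound_real[OF _ _ this, of K "{}"] bound
  have "\<bar>stop_harmonic e a - stop_harmonic e b\<bar> \<le> K * T"
    using T_pos pos by (auto simp: K_def)
  then show "dist (stop_harmonic e a) (stop_harmonic e b) \<le> 10 * m1 * \<omega>\<^sup>2 * T * dist a b"
    by (simp add: K_def dist_norm mult_ac)
qed (use pos T_pos in auto)

text \<open>
  The averaged equations: the amplitudes for which the first order forces are not in resonance
  with the modes.
\<close>

definition averaged_equilibrium :: "real \<Rightarrow> state \<Rightarrow> bool" where
  "averaged_equilibrium k a \<longleftrightarrow> (case a of (C1, S1, C2, S2) \<Rightarrow>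
     \<omega> * T * (- \<alpha> * C1 - \<beta> * S1 + \<mu>) = \<psi>1 * k * stop_harmonic (\<lambda>t. cos (\<omega> * t)) a \<and>
     \<omega> * T * (\<alpha> * S1 - \<beta> * C1) = \<psi>1 * k * stop_harmonic (\<lambda>t. sin (\<omega> * t)) a \<and>
     2 * \<omega> * T * (- \<gamma> * C2 - \<beta>2 * S2) = \<psi>2 * k * stop_harmonic (\<lambda>t. cos (2 * \<omega> * t)) a \<and>
     2 * \<omega> * T * (\<gamma> * S2 - \<beta>2 * C2) = \<psi>2 * k * stop_harmonic (\<lambda>t. sin (2 * \<omega> * t)) a)"

lemma averaged_equilibria:
  obtains \<delta> a where "\<delta> > 0" "\<And>k. 0 < k \<Longrightarrow> k \<le> \<delta> \<Longrightarrow> averaged_equilibrium k (a k)"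
    "(a \<longlongrightarrow> (\<mu> * \<alpha> / (\<alpha>\<^sup>2 + \<beta>\<^sup>2), \<mu> * \<beta> / (\<alpha>\<^sup>2 + \<beta>\<^sup>2), 0, 0)) (at_right 0)"
proof -
  define D1 D2 where "D1 = \<alpha>\<^sup>2 + \<beta>\<^sup>2" and "D2 = \<gamma>\<^sup>2 + \<beta>2\<^sup>2"
  have D: "D1 > 0" "D2 > 0" using pos by (simp_all add: D1_def D2_def \<alpha>_eq \<gamma>_eq add_pos_nonneg)
  define e1 e2 where "e1 = \<psi>1 / (\<omega> * T)" and "e2 = \<psi>2 / (2 * \<omega> * T)"
  define c1 s1 c2 s2 where "c1 = (\<lambda>a. e1 * stop_harmonic (\<lambda>t. cos (\<omega> * t)) a)"
    and "s1 = (\<lambda>a. e1 * stop_harmonic (\<lambda>t. sin (\<omega> * t)) a)"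
    and "c2 = (\<lambda>a. e2 * stop_harmonic (\<lambda>t. cos (2 * \<omega> * t)) a)"
    and "s2 = (\<lambda>a. e2 * stop_harmonic (\<lambda>t. sin (2 * \<omega> * t)) a)"
  define L where "L = 10 * m1 * \<omega>\<^sup>2 * T"
  have L: "L-lipschitz_on UNIV (stop_harmonic (\<lambda>t. cos (\<omega> * t)))"
    "L-lipschitz_on UNIV (stop_harmonic (\<lambda>t. sin (\<omega> * t)))"
    "L-lipschitz_on UNIV (stop_harmonic (\<lambda>t. cos (2 * \<omega> * t)))"
    "L-lipschitz_on UNIV (stop_harmonic (\<lambda>t. sin (2 * \<omega> * t)))"
    unfolding L_def by (intro stop_harmonic_lipschitz continuous_intros abs_cos_le_one abs_sin_le_one)+
  define \<Psi> :: "state \<Rightarrow> state" where "\<Psi> = (\<lambda>a.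
    ((- \<alpha> / D1) * c1 a + (- \<beta> / D1) * s1 a, (- \<beta> / D1) * c1 a + (\<alpha> / D1) * s1 a,
     (- \<gamma> / D2) * c2 a + (- \<beta>2 / D2) * s2 a, (- \<beta>2 / D2) * c2 a + (\<gamma> / D2) * s2 a))"
  have "\<exists>K. K-lipschitz_on UNIV \<Psi>"
    unfolding \<Psi>_def c1_def s1_def c2_def s2_def
    by (rule exI, (rule lipschitz_on_Pair lipschitz_on_add lipschitz_on_cmult_real L)+)
  then obtain K where K: "K-lipschitz_on UNIV \<Psi>" by blast
  obtain \<delta> a where a: "\<delta> > 0"
    "\<And>k. 0 < k \<Longrightarrow> k \<le> \<delta> \<Longrightarrow> a k = (\<mu> * \<alpha> / D1, \<mu> * \<beta> / D1, 0, 0) + k *\<^sub>R \<Psi> (a k)"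
    "(a \<longlongrightarrow> (\<mu> * \<alpha> / D1, \<mu> * \<beta> / D1, 0, 0)) (at_right 0)"
    using perturbed_fixed_point[OF K] by blast
  have "averaged_equilibrium k (a k)" if k: "0 < k" "k \<le> \<delta>" for k
  proof -
    obtain C1 S1 C2 S2 where ak: "a k = (C1, S1, C2, S2)" by (metis surj_pair)
    define p1 q1 p2 q2 where "p1 = c1 (a k)" and "q1 = s1 (a k)" and "p2 = c2 (a k)" and "q2 = s2 (a k)"
    have "(C1, S1, C2, S2) = (\<mu> * \<alpha> / D1, \<mu> * \<beta> / D1, 0, 0) + k *\<^sub>R \<Psi> (a k)"
      using a(2)[OF k] ak by simp
    then have eq: "C1 = (\<mu> * \<alpha> - k * (\<alpha> * p1 + \<beta> * q1)) / D1" "S1 = (\<mu> * \<beta> - k * (\<beta> * p1 - \<alpha> * q1)) / D1"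
      "C2 = - k * (\<gamma> * p2 + \<beta>2 * q2) / D2" "S2 = - k * (\<beta>2 * p2 - \<gamma> * q2) / D2"
      unfolding \<Psi>_def using D
      by (auto simp flip: p1_def q1_def p2_def q2_def simp: field_simps)
    have "D1 * (- \<alpha> * C1 - \<beta> * S1 + \<mu>) = D1 * (k * p1)" "D1 * (\<alpha> * S1 - \<beta> * C1) = D1 * (k * q1)"
      "D2 * (- \<gamma> * C2 - \<beta>2 * S2) = D2 * (k * p2)" "D2 * (\<gamma> * S2 - \<beta>2 * C2) = D2 * (k * q2)"
    proof -
      have m: "D1 * C1 = \<mu> * \<alpha> - k * (\<alpha> * p1 + \<beta> * q1)" "D1 * S1 = \<mu> * \<beta> - k * (\<beta> * p1 - \<alpha> * q1)"
        "D2 * C2 = - k * (\<gamma> * p2 + \<beta>2 * q2)" "D2 * S2 = - k * (\<beta>2 * p2 - \<gamma> * q2)"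
        using eq D by simp_all
      show "D1 * (- \<alpha> * C1 - \<beta> * S1 + \<mu>) = D1 * (k * p1)" "D1 * (\<alpha> * S1 - \<beta> * C1) = D1 * (k * q1)"
        using m(1,2) D1_def by algebra+
      show "D2 * (- \<gamma> * C2 - \<beta>2 * S2) = D2 * (k * p2)" "D2 * (\<gamma> * S2 - \<beta>2 * C2) = D2 * (k * q2)"
        using m(3,4) D2_def by algebra+
    qed
    then have "- \<alpha> * C1 - \<beta> * S1 + \<mu> = k * p1" "\<alpha> * S1 - \<beta> * C1 = k * q1"
      "- \<gamma> * C2 - \<beta>2 * S2 = k * p2" "\<gamma> * S2 - \<beta>2 * C2 = k * q2"
      using D by simp_all
    then show ?thesis
      unfolding averaged_equilibrium_def ak prod.case unfolding ak[symmetric]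
      using pos T_pos
      by (simp add: p1_def q1_def p2_def q2_def c1_def s1_def c2_def s2_def e1_def e2_def)
  qed
  then show ?thesis using that a(1,3) unfolding D1_def by blast
qed

text \<open>The stop excites the second mode.\<close>

lemma averaged_equilibrium_second_mode:
  assumes eq: "averaged_equilibrium k (C1, S1, C2, S2)" and k: "k > 0"
  shows "C2 \<noteq> 0 \<or> S2 \<noteq> 0"
proof (rule ccontr)
  assume "\<not> (C2 \<noteq> 0 \<or> S2 \<noteq> 0)"
  then have z: "C2 = 0" "S2 = 0" by auto
  define a :: state where "a = (C1, S1, C2, S2)"
  have I: "stop_harmonic (\<lambda>t. cos (2 * \<omega> * t)) a = 0" "stop_harmonic (\<lambda>t. sin (2 * \<omega> * t)) a = 0"
    using eq k \<psi>2_neg unfolding averaged_equilibrium_def a_def z by auto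
  have d: "defl a t = (- (m1 * \<omega>\<^sup>2) * C1) * sin (\<omega> * t) + (- (m1 * \<omega>\<^sup>2) * S1) * cos (\<omega> * t)" for t
    by (simp add: a_def z defl_def algebra_simps)
  have cont: "continuous_on UNIV (\<lambda>t. sin (2 * \<omega> * t))" "continuous_on UNIV (\<lambda>t. cos (2 * \<omega> * t))"
    by (intro continuous_intros)+
  note int = stop_harmonic_has_integral[OF cont(1), of a, unfolded d I]
    stop_harmonic_has_integral[OF cont(2), of a, unfolded d I]
  have "- (m1 * \<omega>\<^sup>2) * C1 = 0 \<and> - (m1 * \<omega>\<^sup>2) * S1 = 0"
    by (rule half_wave_second_harmonic[OF \<omega>T pos(6) int])
  then have "C1 = 0" "S1 = 0" using pos by auto
  moreover have "stop_harmonic (\<lambda>t. cos (\<omega> * t)) a = 0"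
    unfolding stop_harmonic_def using calculation by (simp add: d)
  ultimately have "\<omega> * T * \<mu> = 0" using eq unfolding averaged_equilibrium_def a_def by simp
  then show False using \<mu>_nonzero pos T_pos by simp
qed

text \<open>
  The corrector is assembled from the responses of the two modal oscillators; the averaged
  equations are their non-resonance conditions.
\<close>

lemma corrector_exists:
  assumes eq: "averaged_equilibrium k a"
  obtains w where "\<And>t. (w has_vector_derivative (gen (w t) + first_order k t (free_motion a t))) (at t)"
    "\<And>t. w (t + T) = w t"
proof -
  obtain C1 S1 C2 S2 where a: "a = (C1, S1, C2, S2)" by (metis surj_pair)
  define p where "p = (\<lambda>t. max 0 (defl a t))"
  define x2 where "x2 = (\<lambda>t. \<phi>1 * (C1 * sin (\<omega> * t) + S1 * cos (\<omega> * t)) + \<phi>2 * (C2 * sin (2 * \<omega> * t) + S2 * cos (2 * \<omega> * t)))"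
  define x2' where "x2' = (\<lambda>t. \<phi>1 * \<omega> * (C1 * cos (\<omega> * t) - S1 * sin (\<omega> * t)) + 2 * \<phi>2 * \<omega> * (C2 * cos (2 * \<omega> * t) - S2 * sin (2 * \<omega> * t)))"
  define d' where "d' = (\<lambda>t. - (m1 * \<omega>\<^sup>2) * (\<omega> * (C1 * cos (\<omega> * t) - S1 * sin (\<omega> * t))
     + 8 * \<omega> * (C2 * cos (2 * \<omega> * t) - S2 * sin (2 * \<omega> * t))))"
  define F where "F = (\<lambda>t. - k0 * d' t - k0t * defl a t - k * p t + r * cos (\<omega> * t))"
  define G where "G = (\<lambda>t. - k2 * x2' t - k2t * x2 t)"
  have fo: "first_order k t (free_motion a t) = (0, 0, F t, - F t + G t)" for t
  proof -
    define U V where "U = C1 * cos (\<omega> * t) - S1 * sin (\<omega> * t)" and "V = C2 * cos (2 * \<omega> * t) - S2 * sin (2 * \<omega> * t)"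
    have y: "(- (m1 * k0 * \<omega>) * U - 2 * (m1 * k0 * \<omega>) * V) / m1 = - k0 * \<omega> * U - 2 * k0 * \<omega> * V"
      "(m2 * \<phi>1 * \<omega> * U + 2 * (m2 * \<phi>2 * \<omega>) * V) / m2 = x2' t"
      using pos by (simp_all add: x2'_def U_def V_def field_simps)
    have v: "- k0 * \<omega> * U - 2 * k0 * \<omega> * V - x2' t = d' t"
      unfolding x2'_def d'_def U_def[symmetric] V_def[symmetric]
      by (simp add: \<phi>1_def \<phi>2_def algebra_simps)
    have l2: "limit2 m1 k0 \<omega> C1 S1 C2 S2 t = x2 t"
      by (simp add: limit2_def x2_def \<phi>1_def \<phi>2_def)
    have l: "limit1 k0 \<omega> C1 S1 C2 S2 t - x2 t = defl a t"
      by (simp add: a defl_def limit1_def x2_def \<phi>1_def \<phi>2_def algebra_simps)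
    have "damp (free_motion a t) = (0, 0, - (k0 * d' t) - k0t * defl a t,
        - (- (k0 * d' t) - k0t * defl a t) - k2 * x2' t - k2t * x2 t)"
      unfolding a free_motion_def damp_def prod.case Let_def U_def[symmetric] V_def[symmetric] y v l2
      unfolding l unfolding a ..
    then show ?thesis
      by (simp add: first_order_def penetration_free_motion F_def G_def p_def)
  qed
  have p_cont: "continuous_on S p" for S
    unfolding p_def by (intro continuous_intros defl_continuous)
  have F_cont: "continuous_on UNIV F" and G_cont: "continuous_on UNIV G"
    unfolding F_def G_def d'_def x2_def x2'_def by (intro continuous_intros defl_continuous p_cont)+
  have F_per: "F (t + T) = F t" and G_per: "G (t + T) = G t" for t
    by (simp_all add: F_def G_def d'_def x2_def x2'_def p_def defl_periodic trig_periodic)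
  define h1 h2 where "h1 = (\<lambda>t. \<psi>1 * F t - \<sigma> * G t)" and "h2 = (\<lambda>t. \<psi>2 * F t + \<sigma> * G t)"
  \<comment> \<open>the modal forces, up to the stop a combination of the first two harmonics\<close>
  define H1 where "H1 = (\<lambda>t. (2 * \<omega> * (\<alpha> * S1 - \<beta> * C1)) * sin (\<omega> * t) + (2 * \<omega> * (- \<alpha> * C1 - \<beta> * S1 + \<mu>)) * cos (\<omega> * t)
      + (\<psi>1 * (4 * k0t * m1 * \<omega>\<^sup>2 * C2 - 8 * k0 * m1 * \<omega>\<^sup>2 * \<omega> * S2) + \<sigma> * (k2t * \<phi>2 * C2 - 2 * k2 * \<phi>2 * \<omega> * S2)) * sin (2 * \<omega> * t)
      + (\<psi>1 * (4 * k0t * m1 * \<omega>\<^sup>2 * S2 + 8 * k0 * m1 * \<omega>\<^sup>2 * \<omega> * C2) + \<sigma> * (k2t * \<phi>2 * S2 + 2 * k2 * \<phi>2 * \<omega> * C2)) * cos (2 * \<omega> * t))"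
  define H2 where "H2 = (\<lambda>t. (\<psi>2 * (k0t * m1 * \<omega>\<^sup>2 * C1 - k0 * m1 * \<omega>\<^sup>2 * \<omega> * S1) - \<sigma> * (k2t * \<phi>1 * C1 - k2 * \<phi>1 * \<omega> * S1)) * sin (\<omega> * t)
      + (\<psi>2 * (k0t * m1 * \<omega>\<^sup>2 * S1 + k0 * m1 * \<omega>\<^sup>2 * \<omega> * C1 + r) - \<sigma> * (k2t * \<phi>1 * S1 + k2 * \<phi>1 * \<omega> * C1)) * cos (\<omega> * t)
      + (4 * \<omega> * (\<gamma> * S2 - \<beta>2 * C2)) * sin (2 * \<omega> * t) + (4 * \<omega> * (- \<gamma> * C2 - \<beta>2 * S2)) * cos (2 * \<omega> * t))"
  have h1: "h1 t = H1 t - \<psi>1 * k * p t" for t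
  proof -
    define s1 c1 s2 c2 where trig: "s1 = sin (\<omega> * t)" "c1 = cos (\<omega> * t)" "s2 = sin (2 * \<omega> * t)" "c2 = cos (2 * \<omega> * t)"
    have al: "2 * \<alpha> = \<omega>\<^sup>2" by (simp add: \<alpha>_eq)
    show ?thesis
      unfolding h1_def H1_def F_def G_def d'_def x2_def x2'_def a defl_def prod.case trig[symmetric]
      using mode1_damping mode1_detuning mode1_forcing al by algebra
  qed
  have h2: "h2 t = H2 t - \<psi>2 * k * p t" for t
  proof -
    define s1 c1 s2 c2 where trig: "s1 = sin (\<omega> * t)" "c1 = cos (\<omega> * t)" "s2 = sin (2 * \<omega> * t)" "c2 = cos (2 * \<omega> * t)"
    show ?thesis
      unfolding h2_def H2_def F_def G_def d'_def x2_def x2'_def a defl_def prod.case trig[symmetric]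
      using mode2_damping mode2_detuning \<gamma>_eq by algebra
  qed
  have stop: "((\<lambda>t. p t * e t) has_integral stop_harmonic e a) {0..T}" if "continuous_on UNIV e" for e
    unfolding p_def by (rule stop_harmonic_has_integral[OF that])
  have avg: "\<omega> * T * (- \<alpha> * C1 - \<beta> * S1 + \<mu>) = \<psi>1 * k * stop_harmonic (\<lambda>t. cos (\<omega> * t)) a"
    "\<omega> * T * (\<alpha> * S1 - \<beta> * C1) = \<psi>1 * k * stop_harmonic (\<lambda>t. sin (\<omega> * t)) a"
    "2 * \<omega> * T * (- \<gamma> * C2 - \<beta>2 * S2) = \<psi>2 * k * stop_harmonic (\<lambda>t. cos (2 * \<omega> * t)) a"
    "2 * \<omega> * T * (\<gamma> * S2 - \<beta>2 * C2) = \<psi>2 * k * stop_harmonic (\<lambda>t. sin (2 * \<omega> * t)) a"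
    using eq unfolding averaged_equilibrium_def a by auto
  have comb: "((\<lambda>t. (X t - c * p t) * e t) has_integral 0) {0..T}"
    if "((\<lambda>t. X t * e t) has_integral J) {0..T}" "continuous_on UNIV e" "J = c * stop_harmonic e a" for X c e J
  proof -
    have "((\<lambda>t. X t * e t - c * (p t * e t)) has_integral (J - c * stop_harmonic e a)) {0..T}"
      by (intro has_integral_diff has_integral_mult_right that stop)
    then show ?thesis using that(3) by (simp add: algebra_simps)
  qed
  have J: "T / 2 * (2 * \<omega> * x) = \<omega> * T * x" "T / 2 * (4 * \<omega> * x) = 2 * \<omega> * T * x" for x by simp_all
  note trig_int = trig_polynomial_coefficients[OF \<omega>T pos(6)]
  have r1: "((\<lambda>t. h1 t * cos (\<omega> * t)) has_integral 0) {0..T}"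
    unfolding h1 H1_def by (rule comb[OF trig_int(2)], intro continuous_intros, simp only: J avg(1))
  have r2: "((\<lambda>t. h1 t * sin (\<omega> * t)) has_integral 0) {0..T}"
    unfolding h1 H1_def by (rule comb[OF trig_int(1)], intro continuous_intros, simp only: J avg(2))
  have r3: "((\<lambda>t. h2 t * cos (2 * \<omega> * t)) has_integral 0) {0..T}"
    unfolding h2 H2_def by (rule comb[OF trig_int(4)], intro continuous_intros, simp only: J avg(3))
  have r4: "((\<lambda>t. h2 t * sin (2 * \<omega> * t)) has_integral 0) {0..T}"
    unfolding h2 H2_def by (rule comb[OF trig_int(3)], intro continuous_intros, simp only: J avg(4))
  have h_cont: "continuous_on UNIV h1" "continuous_on UNIV h2"
    unfolding h1_def h2_def by (intro continuous_intros F_cont G_cont)+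
  have h_per: "h1 (t + T) = h1 t" "h2 (t + T) = h2 t" for t
    by (simp_all add: h1_def h2_def F_per G_per)
  obtain q1 v1 where q1: "\<And>t. (q1 has_vector_derivative v1 t) (at t)"
    "\<And>t. (v1 has_vector_derivative (h1 t - \<omega>\<^sup>2 * q1 t)) (at t)" "\<And>t. q1 (t + T) = q1 t" "\<And>t. v1 (t + T) = v1 t"
    by (rule oscillator_periodic_response[OF h_cont(1) h_per(1) T_pos _ _ r1 r2, of 1]) (use pos \<omega>T in auto)
  obtain q2 v2 where q2: "\<And>t. (q2 has_vector_derivative v2 t) (at t)"
    "\<And>t. (v2 has_vector_derivative (h2 t - (2 * \<omega>)\<^sup>2 * q2 t)) (at t)" "\<And>t. q2 (t + T) = q2 t" "\<And>t. v2 (t + T) = v2 t"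
    by (rule oscillator_periodic_response[OF h_cont(2) h_per(2) T_pos _ _ r3 r4, of 2]) (use pos \<omega>T in auto)
  define w :: "real \<Rightarrow> state" where "w = (\<lambda>t. (- k0 * q1 t + - k0 * q2 t, \<phi>1 * q1 t + \<phi>2 * q2 t,
    - (m1 * k0) * v1 t + - (m1 * k0) * v2 t, m2 * \<phi>1 * v1 t + m2 * \<phi>2 * v2 t))"
  have D: "(w has_vector_derivative (- k0 * v1 t + - k0 * v2 t, \<phi>1 * v1 t + \<phi>2 * v2 t,
      - (m1 * k0) * (h1 t - \<omega>\<^sup>2 * q1 t) + - (m1 * k0) * (h2 t - (2 * \<omega>)\<^sup>2 * q2 t),
      m2 * \<phi>1 * (h1 t - \<omega>\<^sup>2 * q1 t) + m2 * \<phi>2 * (h2 t - (2 * \<omega>)\<^sup>2 * q2 t))) (at t)" for t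
    unfolding w_def
    by (intro has_vector_derivative_Pair has_vector_derivative_add has_vector_derivative_mult_right q1 q2)
  have "gen (w t) + first_order k t (free_motion a t) = (- k0 * v1 t + - k0 * v2 t, \<phi>1 * v1 t + \<phi>2 * v2 t,
      - (m1 * k0) * (h1 t - \<omega>\<^sup>2 * q1 t) + - (m1 * k0) * (h2 t - (2 * \<omega>)\<^sup>2 * q2 t),
      m2 * \<phi>1 * (h1 t - \<omega>\<^sup>2 * q1 t) + m2 * \<phi>2 * (h2 t - (2 * \<omega>)\<^sup>2 * q2 t))" for t
  proof -
    have "(- (m1 * k0) * v1 t + - (m1 * k0) * v2 t) / m1 = - k0 * v1 t + - k0 * v2 t"
      "(m2 * \<phi>1 * v1 t + m2 * \<phi>2 * v2 t) / m2 = \<phi>1 * v1 t + \<phi>2 * v2 t"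
      using pos by (simp_all add: field_simps)
    moreover have "- (k0 * (- k0 * q1 t + - k0 * q2 t - (\<phi>1 * q1 t + \<phi>2 * q2 t))) + F t
        = - (m1 * k0) * (h1 t - \<omega>\<^sup>2 * q1 t) + - (m1 * k0) * (h2 t - (2 * \<omega>)\<^sup>2 * q2 t)"
      unfolding h1_def h2_def using \<phi>1_def \<phi>2_def \<psi>_k0 \<sigma>_mult by algebra
    moreover have "k0 * (- k0 * q1 t + - k0 * q2 t - (\<phi>1 * q1 t + \<phi>2 * q2 t)) - k2 * (\<phi>1 * q1 t + \<phi>2 * q2 t)
        + (- F t + G t) = m2 * \<phi>1 * (h1 t - \<omega>\<^sup>2 * q1 t) + m2 * \<phi>2 * (h2 t - (2 * \<omega>)\<^sup>2 * q2 t)"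
    proof -
      have nz: "m1 * k0 \<noteq> 0" using pos by simp
      have "m1 * k0 * (m2 * \<phi>1 * \<psi>1 + m2 * \<phi>2 * \<psi>2) = m1 * k0 * - 1"
        using \<psi>_k0 \<sigma>_mult \<phi>_diff by algebra
      then have A: "m2 * \<phi>1 * \<psi>1 + m2 * \<phi>2 * \<psi>2 = - 1" using nz by (simp only: mult_cancel_left) simp
      have B: "m2 * \<sigma> * (\<phi>2 - \<phi>1) = 1" using \<sigma>_mult \<phi>_diff by algebra
      show ?thesis
        unfolding h1_def h2_def using A B mode1 mode2 \<phi>1_def \<phi>2_def by algebra
    qed
    ultimately show ?thesis unfolding fo w_def gen_def prod.case by simp
  qed
  moreover have "w (t + T) = w t" for t by (simp add: w_def q1 q2)
  ultimately show ?thesis using that D by metis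
qed

end

section \<open>Existence and stability of the resonant periodic motion\<close>

lemma exponential_attraction_imp_asymptotically_stable:
  assumes K: "K > 0" "k > 0"
    and attract: "\<And>t0 w t. solves_on f {t0..} w \<Longrightarrow> t \<ge> t0 \<Longrightarrow>
      norm (w t - z t) \<le> K * exp (- k * (t - t0)) * norm (w t0 - z t0)"
  shows "asymptotically_stable f z"
  unfolding asymptotically_stable_def lyapunov_stable_def
proof (intro conjI allI impI)
  fix t0 e :: real assume e: "e > 0"
  show "\<exists>d>0. \<forall>w. solves_on f {t0..} w \<and> dist (w t0) (z t0) < d \<longrightarrow> (\<forall>t\<ge>t0. dist (w t) (z t) < e)"
  proof (intro exI[of _ "e / K"] conjI allI impI)
    fix w t assume w: "solves_on f {t0..} w \<and> dist (w t0) (z t0) < e / K" and t: "t0 \<le> t"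
    have "norm (w t - z t) \<le> K * exp (- k * (t - t0)) * norm (w t0 - z t0)"
      using attract w t by blast
    also have "\<dots> \<le> K * 1 * norm (w t0 - z t0)"
      using K t by (intro mult_right_mono mult_left_mono) auto
    also have "\<dots> < K * 1 * (e / K)"
      using K w by (intro mult_strict_left_mono) (auto simp: dist_norm)
    finally show "dist (w t) (z t) < e" using K by (simp add: dist_norm)
  qed (use e K in auto)
next
  fix t0 :: real
  show "\<exists>d>0. \<forall>w. solves_on f {t0..} w \<and> dist (w t0) (z t0) < d \<longrightarrow> ((\<lambda>t. dist (w t) (z t)) \<longlongrightarrow> 0) at_top"
  proof (intro exI[of _ 1] conjI allI impI)
    fix w assume w: "solves_on f {t0..} w \<and> dist (w t0) (z t0) < 1"
    have "filterlim (\<lambda>t. k * (t - t0)) at_top at_top"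
      using K(2) by (intro filterlim_tendsto_pos_mult_at_top[OF tendsto_const] filterlim_at_top_add_at_top
          filterlim_tendsto_add_at_top[OF tendsto_const[of "- t0"] filterlim_ident, simplified])
    then have "((\<lambda>t. exp (- (k * (t - t0)))) \<longlongrightarrow> 0) at_top"
      by (intro filterlim_compose[OF exp_at_bot] filterlim_compose[OF filterlim_uminus_at_bot_at_top])
    then have "((\<lambda>t. K * exp (- (k * (t - t0))) * norm (w t0 - z t0)) \<longlongrightarrow> K * 0 * norm (w t0 - z t0)) at_top"
      by (intro tendsto_intros)
    then have "((\<lambda>t. K * exp (- (k * (t - t0))) * norm (w t0 - z t0)) \<longlongrightarrow> 0) at_top" by simp
    moreover have "\<forall>\<^sub>F t in at_top. norm (dist (w t) (z t)) \<le> K * exp (- (k * (t - t0))) * norm (w t0 - z t0)"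
      using eventually_ge_at_top[of t0] by eventually_elim (use attract w in \<open>auto simp: dist_norm\<close>)
    ultimately show "((\<lambda>t. dist (w t) (z t)) \<longlongrightarrow> 0) at_top" by (rule Lim_null_comparison[rotated])
  qed simp
qed

lemma resonant_frequency:
  assumes pos: "m1 > 0" "m2 > 0" "k0 > 0" "k2 > 0"
    and res: "4 * ((k2 + k0) / m2 + k0 / m1)\<^sup>2 = 25 * (k0 * k2 / (m1 * m2))"
  shows "omega1 m1 m2 k0 k2 > 0" "(k0 + k2) / m2 + k0 / m1 = 5 * (omega1 m1 m2 k0 k2)\<^sup>2"
    "k0 * k2 / (m1 * m2) = 4 * omega1 m1 m2 k0 k2 ^ 4"
proof -
  define s where "s = (k0 + k2) / m2 + k0 / m1"
  have s: "s > 0" using pos by (simp add: s_def add_pos_pos)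
  have res': "k0 * k2 / (m1 * m2) = 4 / 25 * s\<^sup>2"
    using res by (simp add: s_def add.commute)
  have "((k0 + k2) / m2 - k0 / m1)\<^sup>2 + 4 * k0\<^sup>2 / (m1 * m2) = s\<^sup>2 - 4 * (k0 * k2 / (m1 * m2))"
    using pos by (simp add: s_def power2_eq_square field_simps)
  also have "\<dots> = (3 / 5 * s)\<^sup>2" unfolding res' by (simp add: power2_eq_square)
  finally have "sqrt (((k0 + k2) / m2 - k0 / m1)\<^sup>2 + 4 * k0\<^sup>2 / (m1 * m2)) = 3 / 5 * s"
    using s by simp
  then have \<omega>: "omega1 m1 m2 k0 k2 = sqrt (s / 5)"
    unfolding omega1_def by (simp flip: s_def)
  show "omega1 m1 m2 k0 k2 > 0" using s by (simp add: \<omega>)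
  show "(k0 + k2) / m2 + k0 / m1 = 5 * (omega1 m1 m2 k0 k2)\<^sup>2"
    using s by (simp add: \<omega> flip: s_def)
  have "omega1 m1 m2 k0 k2 ^ 4 = ((omega1 m1 m2 k0 k2)\<^sup>2)\<^sup>2" by simp
  also have "\<dots> = (s / 5)\<^sup>2" using s by (simp add: \<omega>)
  finally show "k0 * k2 / (m1 * m2) = 4 * omega1 m1 m2 k0 k2 ^ 4"
    unfolding res' by (simp add: power2_eq_square)
qed

lemma pos_diff_le: "\<bar>pos1 z - pos1 w\<bar> \<le> norm (z - w)" "\<bar>pos2 z - pos2 w\<bar> \<le> norm (z - w)"
proof -
  obtain a b c d where e: "z - w = (a, b, c, d)" by (metis surj_pair)
  have "fst (z - w) = a" "fst (snd (z - w)) = b" unfolding e by simp_all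
  then have "fst z - fst w = a" "fst (snd z) - fst (snd w) = b" by simp_all
  then show "\<bar>pos1 z - pos1 w\<bar> \<le> norm (z - w)" "\<bar>pos2 z - pos2 w\<bar> \<le> norm (z - w)"
    unfolding e by (simp_all add: pos1_def pos2_def abs_le_norm_state)
qed

context resonance_screen
begin

lemma field_periodic: "field k \<epsilon> (t + T) z = field k \<epsilon> t z"
  unfolding field_expansion by (simp add: first_order_def second_order_def rest_force_def trig_periodic)

lemma periodic_motion_near_free_motion:
  assumes eq: "averaged_equilibrium k a"
    and diss: "c > 0" "\<And>t z w. energy (z - w) (first_order k t z - first_order k t w)
       + energy_correction \<kappa> (z - w) (gen (z - w)) \<le> - c * (norm (z - w))\<^sup>2"
  obtains \<epsilon>0 C z where "\<epsilon>0 > 0" "C \<ge> 0"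
    "\<And>\<epsilon>. 0 < \<epsilon> \<Longrightarrow> \<epsilon> \<le> \<epsilon>0 \<Longrightarrow> periodic_solution (field k \<epsilon>) T (z \<epsilon>)"
    "\<And>\<epsilon> w. 0 < \<epsilon> \<Longrightarrow> \<epsilon> \<le> \<epsilon>0 \<Longrightarrow> periodic_solution (field k \<epsilon>) T w \<Longrightarrow> w = z \<epsilon>"
    "\<And>\<epsilon> t. 0 < \<epsilon> \<Longrightarrow> \<epsilon> \<le> \<epsilon>0 \<Longrightarrow> norm (z \<epsilon> t - free_motion a t) \<le> C * \<epsilon>"
    "\<And>\<epsilon>. 0 < \<epsilon> \<Longrightarrow> \<epsilon> \<le> \<epsilon>0 \<Longrightarrow> asymptotically_stable (field k \<epsilon>) (z \<epsilon>)"
proof -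
  obtain h where h: "h > 0" "\<And>u. h * (norm u)\<^sup>2 \<le> energy u u" by (rule energy_coercive) blast
  obtain Lg where Lg: "\<And>t z w. norm (first_order k t z - first_order k t w) \<le> Lg * norm (z - w)"
    by (rule first_order_lipschitz) blast
  obtain Lr where Lr: "\<And>\<epsilon> t z w. 0 < \<epsilon> \<Longrightarrow> \<epsilon> \<le> 1 \<Longrightarrow>
    norm (second_order k \<epsilon> t z - second_order k \<epsilon> t w) \<le> Lr * norm (z - w)"
    by (rule second_order_lipschitz) blast
  obtain Cr where Cr: "\<And>\<epsilon> t. 0 < \<epsilon> \<Longrightarrow> \<epsilon> \<le> 1 \<Longrightarrow> norm (second_order k \<epsilon> t 0) \<le> Cr"
    by (rule second_order_bound) blast
  obtain w0 where w0: "\<And>t. (w0 has_vector_derivative (gen (w0 t) + first_order k t (free_motion a t))) (at t)"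
    "\<And>t. w0 (t + T) = w0 t"
    by (rule corrector_exists[OF eq]) blast
  obtain \<epsilon>0 C z where z: "\<epsilon>0 > 0" "C \<ge> 0"
    "\<And>\<epsilon> t. 0 < \<epsilon> \<Longrightarrow> \<epsilon> \<le> \<epsilon>0 \<Longrightarrow> (z \<epsilon> has_vector_derivative field k \<epsilon> t (z \<epsilon> t)) (at t)"
    "\<And>\<epsilon> t. 0 < \<epsilon> \<Longrightarrow> \<epsilon> \<le> \<epsilon>0 \<Longrightarrow> z \<epsilon> (t + T) = z \<epsilon> t"
    "\<And>\<epsilon> w. 0 < \<epsilon> \<Longrightarrow> \<epsilon> \<le> \<epsilon>0 \<Longrightarrow> (\<And>t. (w has_vector_derivative field k \<epsilon> t (w t)) (at t)) \<Longrightarrow>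
      (\<And>t. w (t + T) = w t) \<Longrightarrow> w = z \<epsilon>"
    "\<And>\<epsilon> t. 0 < \<epsilon> \<Longrightarrow> \<epsilon> \<le> \<epsilon>0 \<Longrightarrow> norm (z \<epsilon> t - free_motion a t) \<le> C * \<epsilon>"
    "\<And>\<epsilon>. 0 < \<epsilon> \<Longrightarrow> \<epsilon> \<le> \<epsilon>0 \<Longrightarrow> \<exists>K>0. \<exists>l>0. \<forall>t0 w.
      (\<forall>t\<ge>t0. (w has_vector_derivative field k \<epsilon> t (w t)) (at t within {t0..})) \<longrightarrow>
      (\<forall>t\<ge>t0. norm (w t - z \<epsilon> t) \<le> K * exp (- l * (t - t0)) * norm (w t0 - z \<epsilon> t0))"
    by (rule weakly_perturbed_periodic[OF bounded_linear_gen bounded_bilinear_energy energy_sym h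
        bounded_bilinear_energy_correction energy_correction_sym energy_conserved diss Lg Lr Cr
        field_expansion field_continuous field_periodic T_pos free_motion_solves free_motion_periodic w0])
      blast+
  have "asymptotically_stable (field k \<epsilon>) (z \<epsilon>)" if \<epsilon>: "0 < \<epsilon>" "\<epsilon> \<le> \<epsilon>0" for \<epsilon>
  proof -
    obtain K l where K: "K > 0" "l > 0" "\<And>t0 w t. (\<forall>t\<ge>t0. (w has_vector_derivative field k \<epsilon> t (w t)) (at t within {t0..}))
        \<Longrightarrow> t \<ge> t0 \<Longrightarrow> norm (w t - z \<epsilon> t) \<le> K * exp (- l * (t - t0)) * norm (w t0 - z \<epsilon> t0)"
      using z(7)[OF \<epsilon>] by blast
    show ?thesis
      by (rule exponential_attraction_imp_asymptotically_stable[OF K(1,2)]) (use K(3) in \<open>auto simp: solves_on_def\<close>)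
  qed
  then show ?thesis
    using z(1-6) by (intro that[of \<epsilon>0 C z]) (auto simp: periodic_solution_def solves_on_def)
qed

end

theorem mainTheorem1:
  fixes m1 m2 k0b k2b k0t k2t r \<omega> \<alpha> \<beta> \<gamma> \<mu> :: real
  assumes "m1 > 0" "m2 > 0" "k0b > 0" "k2b > 0" "r > 0"
    and "4 * ((k2b + k0b) / m2 + k0b / m1)\<^sup>2 = 25 * (k0b * k2b / (m1 * m2))"
    and "\<omega> = omega1 m1 m2 k0b k2b"
    and "\<alpha> = coef_alpha m1 m2 k0b k2b \<omega>"
    and "\<beta> = coef_beta m1 m2 k0b k0t k2t \<omega>"
    and "\<gamma> = coef_gamma m1 m2 k0b k2b \<omega>"
    and "\<mu> = coef_mu m1 m2 k0b r \<omega>"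
    and "\<alpha> > 0" "\<gamma> > 0"
    and "m1 * m2 * \<omega>\<^sup>2 \<noteq> k0b * (m1 + m2)"
  shows "\<exists>\<delta>>0. \<exists>A1C A1S A2C A2S :: real \<Rightarrow> real.
    (\<forall>k1h\<in>{0<..\<delta>}.
       let f = screen_field m1 m2 k0b k2b k0t k2t (\<lambda>t. r * cos (\<omega> * t)) k1h;
           X1 = limit1 k0b \<omega> (A1C k1h) (A1S k1h) (A2C k1h) (A2S k1h);
           X2 = limit2 m1 k0b \<omega> (A1C k1h) (A1S k1h) (A2C k1h) (A2S k1h)
       in (A2C k1h \<noteq> 0 \<or> A2S k1h \<noteq> 0) \<and>
          (\<exists>\<epsilon>0>0. \<exists>\<rho>>0. \<exists>z :: real \<Rightarrow> real \<Rightarrow> state.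
             (\<forall>\<epsilon>\<in>{0<..\<epsilon>0}.
                periodic_solution (f \<epsilon>) (2 * pi / \<omega>) (z \<epsilon>) \<and>
                positions_near \<rho> X1 X2 (z \<epsilon>) \<and>
                (\<forall>w. periodic_solution (f \<epsilon>) (2 * pi / \<omega>) w \<and> positions_near \<rho> X1 X2 w \<longrightarrow> w = z \<epsilon>) \<and>
                asymptotically_stable (f \<epsilon>) (z \<epsilon>)) \<and>
             uniform_limit UNIV (\<lambda>\<epsilon> t. pos1 (z \<epsilon> t)) X1 (at_right 0) \<and>
             uniform_limit UNIV (\<lambda>\<epsilon> t. pos2 (z \<epsilon> t)) X2 (at_right 0))) \<and>
    ((\<lambda>k1h. (A1C k1h, A1S k1h, A2C k1h, A2S k1h)) \<longlongrightarrow>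
       (\<mu> * \<alpha> / (\<alpha>\<^sup>2 + \<beta>\<^sup>2), \<mu> * \<beta> / (\<alpha>\<^sup>2 + \<beta>\<^sup>2), 0, 0)) (at_right 0)"
proof -
  interpret S: resonance_screen m1 m2 k0b k2b k0t k2t r \<omega>
    using assms(1-7) resonant_frequency[OF assms(1-4,6)] by unfold_locales auto
  have coef: "S.\<alpha> = \<alpha>" "S.\<beta> = \<beta>" "S.\<mu> = \<mu>"
    by (simp_all only: S.\<alpha>_def S.\<beta>_def S.\<mu>_def assms(8,9,11))
  obtain \<delta>1 a where a: "\<delta>1 > 0" "\<And>k. 0 < k \<Longrightarrow> k \<le> \<delta>1 \<Longrightarrow> S.averaged_equilibrium k (a k)"
    "(a \<longlongrightarrow> (\<mu> * \<alpha> / (\<alpha>\<^sup>2 + \<beta>\<^sup>2), \<mu> * \<beta> / (\<alpha>\<^sup>2 + \<beta>\<^sup>2), 0, 0)) (at_right 0)"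
    using S.averaged_equilibria unfolding coef by blast
  obtain \<delta>2 \<kappa> c where diss: "\<delta>2 > 0" "c > 0"
    "\<And>k t z w. 0 < k \<Longrightarrow> k \<le> \<delta>2 \<Longrightarrow> S.energy (z - w) (S.first_order k t z - S.first_order k t w)
       + S.energy_correction \<kappa> (z - w) (S.gen (z - w)) \<le> - c * (norm (z - w))\<^sup>2"
    by (rule S.first_order_dissipative) blast
  define A1C A1S A2C A2S where "A1C = (\<lambda>k. fst (a k))" and "A1S = (\<lambda>k. fst (snd (a k)))"
    and "A2C = (\<lambda>k. fst (snd (snd (a k))))" and "A2S = (\<lambda>k. snd (snd (snd (a k))))"
  have A: "a k = (A1C k, A1S k, A2C k, A2S k)" for k
    by (simp add: A1C_def A1S_def A2C_def A2S_def)
  define X1 where "X1 = (\<lambda>k. limit1 k0b \<omega> (A1C k) (A1S k) (A2C k) (A2S k))"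
  define X2 where "X2 = (\<lambda>k. limit2 m1 k0b \<omega> (A1C k) (A1S k) (A2C k) (A2S k))"
  have X: "pos1 (S.free_motion (a k) t) = X1 k t" "pos2 (S.free_motion (a k) t) = X2 k t" for k t
    by (simp_all add: A S.free_motion_def pos1_def pos2_def X1_def X2_def)
  have second_mode: "A2C k \<noteq> 0 \<or> A2S k \<noteq> 0" if "0 < k" "k \<le> \<delta>1" for k
    using S.averaged_equilibrium_second_mode[of k "A1C k" "A1S k" "A2C k" "A2S k"] a(2)[OF that] that
    by (simp add: A)
  have motion: "\<exists>\<epsilon>0>0. \<exists>\<rho>>0. \<exists>z :: real \<Rightarrow> real \<Rightarrow> state.
      (\<forall>\<epsilon>\<in>{0<..\<epsilon>0}.
         periodic_solution (S.field k \<epsilon>) (2 * pi / \<omega>) (z \<epsilon>) \<and>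
         positions_near \<rho> (X1 k) (X2 k) (z \<epsilon>) \<and>
         (\<forall>w. periodic_solution (S.field k \<epsilon>) (2 * pi / \<omega>) w \<and> positions_near \<rho> (X1 k) (X2 k) w \<longrightarrow> w = z \<epsilon>) \<and>
         asymptotically_stable (S.field k \<epsilon>) (z \<epsilon>)) \<and>
      uniform_limit UNIV (\<lambda>\<epsilon> t. pos1 (z \<epsilon> t)) (X1 k) (at_right 0) \<and>
      uniform_limit UNIV (\<lambda>\<epsilon> t. pos2 (z \<epsilon> t)) (X2 k) (at_right 0)"
    if k: "0 < k" "k \<le> \<delta>1" "k \<le> \<delta>2" for k
  proof -
    obtain \<epsilon>0 C z where z: "\<epsilon>0 > 0" "C \<ge> 0"
      "\<And>\<epsilon>. 0 < \<epsilon> \<Longrightarrow> \<epsilon> \<le> \<epsilon>0 \<Longrightarrow> periodic_solution (S.field k \<epsilon>) S.T (z \<epsilon>)"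
      "\<And>\<epsilon> w. 0 < \<epsilon> \<Longrightarrow> \<epsilon> \<le> \<epsilon>0 \<Longrightarrow> periodic_solution (S.field k \<epsilon>) S.T w \<Longrightarrow> w = z \<epsilon>"
      "\<And>\<epsilon> t. 0 < \<epsilon> \<Longrightarrow> \<epsilon> \<le> \<epsilon>0 \<Longrightarrow> norm (z \<epsilon> t - S.free_motion (a k) t) \<le> C * \<epsilon>"
      "\<And>\<epsilon>. 0 < \<epsilon> \<Longrightarrow> \<epsilon> \<le> \<epsilon>0 \<Longrightarrow> asymptotically_stable (S.field k \<epsilon>) (z \<epsilon>)"
      by (rule S.periodic_motion_near_free_motion[OF a(2)[OF k(1,2)] diss(2) diss(3)[OF k(1,3)]]) blast
    have near: "\<bar>pos1 (z \<epsilon> t) - X1 k t\<bar> < e \<and> \<bar>pos2 (z \<epsilon> t) - X2 k t\<bar> < e"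
      if "0 < \<epsilon>" "\<epsilon> \<le> \<epsilon>0" "\<epsilon> \<le> e / (C + 1)" for \<epsilon> t e
    proof -
      have "C * \<epsilon> < (C + 1) * \<epsilon>" using that by simp
      also have "\<dots> \<le> e" using that z(2) by (simp add: pos_le_divide_eq mult.commute)
      finally show ?thesis
        using z(5)[OF that(1,2), of t] pos_diff_le[of "z \<epsilon> t" "S.free_motion (a k) t"]
        unfolding X by linarith
    qed
    have lim: "\<forall>\<^sub>F \<epsilon> in at_right 0. \<forall>t. \<bar>pos1 (z \<epsilon> t) - X1 k t\<bar> < e \<and> \<bar>pos2 (z \<epsilon> t) - X2 k t\<bar> < e"
      if "e > 0" for e
    proof -
      have "min \<epsilon>0 (e / (C + 1)) > 0" using that z(1,2) by auto
      from eventually_at_right_real[OF this] show ?thesis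
        by eventually_elim (use near in auto)
    qed
    show ?thesis
      \<comment> \<open>up to this bound on \<open>\<epsilon>\<close> the solution stays within distance 1 of the free motion, so \<open>\<rho> = 1\<close> will do\<close>
    proof (rule exI[of _ "min \<epsilon>0 (1 / (C + 1))"], rule conjI, goal_cases)
      case 1
      show ?case using z(1,2) by auto
    next
      case 2
      show ?case
      proof (rule exI[of _ 1], rule conjI, simp, rule exI[of _ z], intro conjI ballI)
      show "uniform_limit UNIV (\<lambda>\<epsilon> t. pos1 (z \<epsilon> t)) (X1 k) (at_right 0)"
        "uniform_limit UNIV (\<lambda>\<epsilon> t. pos2 (z \<epsilon> t)) (X2 k) (at_right 0)"
        by (rule uniform_limitI; use lim in \<open>force simp: dist_real_def elim: eventually_mono\<close>)+
      fix \<epsilon> assume "\<epsilon> \<in> {0<..min \<epsilon>0 (1 / (C + 1))}"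
      then have \<epsilon>: "0 < \<epsilon>" "\<epsilon> \<le> \<epsilon>0" "\<epsilon> \<le> 1 / (C + 1)" by auto
      show "periodic_solution (S.field k \<epsilon>) (2 * pi / \<omega>) (z \<epsilon>)"
        using z(3)[OF \<epsilon>(1,2)] by (simp add: S.T_def)
      show "positions_near 1 (X1 k) (X2 k) (z \<epsilon>)"
        using near[OF \<epsilon>] by (simp add: positions_near_def)
      show "\<forall>w. periodic_solution (S.field k \<epsilon>) (2 * pi / \<omega>) w \<and> positions_near 1 (X1 k) (X2 k) w \<longrightarrow> w = z \<epsilon>"
        using z(4)[OF \<epsilon>(1,2)] by (auto simp: S.T_def)
      show "asymptotically_stable (S.field k \<epsilon>) (z \<epsilon>)" using z(6)[OF \<epsilon>(1,2)] .
      qed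
    qed
  qed
  have amplitudes_tendsto: "((\<lambda>k. (A1C k, A1S k, A2C k, A2S k)) \<longlongrightarrow>
      (\<mu> * \<alpha> / (\<alpha>\<^sup>2 + \<beta>\<^sup>2), \<mu> * \<beta> / (\<alpha>\<^sup>2 + \<beta>\<^sup>2), 0, 0)) (at_right 0)"
    using a(3) by (simp flip: A)
  show ?thesis
    unfolding Let_def
  proof (rule exI[of _ "min \<delta>1 \<delta>2"], rule conjI, goal_cases)
    case 1
    show ?case using a(1) diss(1) by simp
  next
    case 2
    show ?case
    proof (rule exI[of _ A1C], rule exI[of _ A1S], rule exI[of _ A2C], rule exI[of _ A2S], intro conjI ballI)
      fix k assume "k \<in> {0<..min \<delta>1 \<delta>2}"
      then have k: "0 < k" "k \<le> \<delta>1" "k \<le> \<delta>2" by auto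
      show "A2C k \<noteq> 0 \<or> A2S k \<noteq> 0" by (rule second_mode[OF k(1,2)])
    qed (use motion amplitudes_tendsto in \<open>auto simp: X1_def X2_def\<close>)
  qed
qed

end
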